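(* Let $b\ge 2$ be an integer. For each integer $n\ge 0$ let $X_n$ denote the evil-location of a random $n$-evil real number in base $b$ (defined in the context), and let $\mu_n=E[X_n]$. Then there is a constant $\alpha_b$ with $0<\alpha_b<1$ such that, for fixed $b$ and $n\to\infty$: (i) $$E[X_n]=\frac{2}{b-1}\,n+\frac{b-5}{3(b-1)}+O(\alpha_b^n).$$ (ii) $$\operatorname{Var}(X_n)=\frac{2(b+1)}{3(b-1)^2}\,n+\frac{2b^2-14b+2}{9(b-1)^2}+O(\alpha_b^n).$$ (iii) $$E[(X_n-\mu_n)^3]=\frac{2(b+1)^2}{3(b-1)^3}\,n+\frac{2(b+1)(11b^2-95b+11)}{135(b-1)^3}+O(\alpha_b^n),$$ and consequently the skewness $E[(X_n-\mu_n)^3]/\operatorname{Var}(X_n)^{3/2}$ tends to $0$ as $n\to\infty$. (iv) $$E[(X_n-\mu_n)^4]=\frac{4(b+1)^2}{3(b-1)^4}\,n^2+\frac{2(b+1)(13b^2-30b+13)}{15(b-1)^4}\,n+\frac{2(17b^2-11b+17)(b^2-10b+1)}{135(b-1)^4}+O(\alpha_b^n),$$ and consequently the kurtosis $E[(X_n-\mu_n)^4]/\operatorname{Var}(X_n)^2$ tends to $3$ as $n\to\infty$. (v) $$E[(X_n-\mu_n)^5]=\frac{40(b+1)^3}{9(b-1)^5}\,n^2+\frac{10(31b^2-118b+31)(b+1)^2}{81(b-1)^5}\,n+\frac{2(b+1)(293b^4-4291b^3+7356b^2-4291b+293)}{1701(b-1)^5}+O(\alpha_b^n),$$ and consequently the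 scaled fifth central moment $E[(X_n-\mu_n)^5]/\operatorname{Var}(X_n)^{5/2}$ tends to $0$ as $n\to\infty$.
   Context: A random real number in base $b$ is modelled by independent random digits $d_1,d_2,d_3,\dots$ with $d_1$ uniform on $\{1,\dots,b-1\}$ and $d_j$ uniform on $\{0,1,\dots,b-1\}$ for $j\ge 2$. Put $s_0=0$ and $s_k=d_1+\dots+d_k$. The number is $n$-evil to base $b$ if $s_k=n$ for some $k\ge 0$, and then its evil-location is the smallest such $k$. $X_n$ is the evil-location, conditioned on the number being $n$-evil: $P(X_n=k)=A_b(n,k)/\sum_{j\ge 0}A_b(n,j)$, where $A_b(n,k)$ is the probability that $s_k=n$ and $s_j\ne n$ for all $0\le j<k$. *)

theory Defs
  imports "HOL-Probability.Probability"
begin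

definition digit_pmf :: "nat \<Rightarrow> nat \<Rightarrow> nat pmf" where
  "digit_pmf b j = pmf_of_set (if j = 1 then {1..b - 1} else {0..b - 1})"

text \<open>The product measure makes the digits independent; digit positions start at \<open>1\<close>.\<close>

definition digits :: "nat \<Rightarrow> (nat \<Rightarrow> nat) measure" where
  "digits b = PiM {1..} (\<lambda>j. measure_pmf (digit_pmf b j))"

definition digit_sum :: "(nat \<Rightarrow> nat) \<Rightarrow> nat \<Rightarrow> nat" where
  "digit_sum d k = (\<Sum>j = 1..k. d j)"

definition evil :: "nat \<Rightarrow> (nat \<Rightarrow> nat) \<Rightarrow> bool" where
  "evil n d \<longleftrightarrow> (\<exists>k. digit_sum d k = n)"

text \<open>Arbitrary unless \<open>d\<close> is \<open>n\<close>-evil.\<close>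

definition evil_location :: "nat \<Rightarrow> (nat \<Rightarrow> nat) \<Rightarrow> nat" where
  "evil_location n d = (LEAST k. digit_sum d k = n)"

text \<open>
  The law of the digits conditioned on the number being \<open>n\<close>-evil. The random variable \<open>X\<^sub>n\<close>
  is \<open>evil_location n\<close> on this space.
\<close>

definition evil_digits :: "nat \<Rightarrow> nat \<Rightarrow> (nat \<Rightarrow> nat) measure" where
  "evil_digits b n = uniform_measure (digits b) {d \<in> space (digits b). evil n d}"

definition evil_mean :: "nat \<Rightarrow> nat \<Rightarrow> real" where
  "evil_mean b n = (\<integral>d. real (evil_location n d) \<partial>evil_digits b n)"

definition evil_central_moment :: "nat \<Rightarrow> nat \<Rightarrow> nat \<Rightarrow> real" where
  "evil_central_moment r b n =
     (\<integral>d. (real (evil_location n d) - evil_mean b n) ^ r \<partial>evil_digits b n)"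

definition evil_variance :: "nat \<Rightarrow> nat \<Rightarrow> real" where
  "evil_variance b n = evil_central_moment 2 b n"

definition first_hit_prob :: "nat \<Rightarrow> nat \<Rightarrow> nat \<Rightarrow> real" where
  "first_hit_prob b n k =
     measure (digits b)
       {d \<in> space (digits b). digit_sum d k = n \<and> (\<forall>j<k. digit_sum d j \<noteq> n)}"

lemma prob_space_digits: "prob_space (digits b)"
  unfolding digits_def by (rule prob_space_PiM) (rule prob_space_measure_pmf)

lemma measurable_digit_sum [measurable]:
  "(\<lambda>d. digit_sum d k) \<in> measurable (digits b) (count_space UNIV)"
proof -
  have "(\<lambda>d. d j) \<in> measurable (digits b) (count_space UNIV)" if "j \<in> {1..k}" for j
  proof -
    have "(\<lambda>d. d j) \<in> measurable (digits b) (measure_pmf (digit_pmf b j))"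
      unfolding digits_def using that by (intro measurable_component_singleton) auto
    thus ?thesis by simp
  qed
  thus ?thesis
    unfolding digit_sum_def by (intro measurable_sum_nat) auto
qed

lemma measurable_evil [measurable]: "Measurable.pred (digits b) (evil n)"
  unfolding evil_def by measurable

lemma measurable_evil_location [measurable]:
  "evil_location n \<in> measurable (digits b) (count_space UNIV)"
  unfolding evil_location_def by measurable

lemma evil_set [measurable]: "{d \<in> space (digits b). evil n d} \<in> sets (digits b)"
  by measurable

lemma evil_prob_pos:
  assumes "b \<ge> 2"
  shows "measure (digits b) {d \<in> space (digits b). evil n d} > 0"
proof -
  interpret product_prob_space "\<lambda>j. measure_pmf (digit_pmf b j)" "{1..}"
    by standard
  interpret D: prob_space "digits b" by (rule prob_space_digits)
  let ?S = "{d \<in> space (digits b). \<forall>j\<in>{1..n}. d j \<in> {1}}"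
  have "emeasure (digits b) ?S = (\<Prod>j\<in>{1..n}. emeasure (measure_pmf (digit_pmf b j)) {1})"
    unfolding digits_def by (rule emeasure_PiM_Collect) auto
  hence "measure (digits b) ?S = (\<Prod>j\<in>{1..n}. measure (measure_pmf (digit_pmf b j)) {1})"
    by (simp add: D.emeasure_eq_measure measure_pmf.emeasure_eq_measure prod_ennreal
          prod_nonneg)
  also have "\<dots> > 0"
    using assms by (intro prod_pos) (auto simp: digit_pmf_def measure_pmf_single)
  also have "?S \<subseteq> {d \<in> space (digits b). evil n d}"
    by (auto simp: evil_def digit_sum_def intro!: exI[of _ n])
  hence "measure (digits b) ?S \<le> measure (digits b) {d \<in> space (digits b). evil n d}"
    by (intro D.finite_measure_mono) auto
  finally show ?thesis by simp
qed

lemma prob_space_evil_digits: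
  assumes "b \<ge> 2"
  shows "prob_space (evil_digits b n)"
proof -
  interpret D: prob_space "digits b" by (rule prob_space_digits)
  show ?thesis
    unfolding evil_digits_def using evil_prob_pos[OF assms, of n]
    by (intro prob_space_uniform_measure) (auto simp: D.emeasure_eq_measure)
qed

lemma first_hit_iff:
  "digit_sum d k = n \<and> (\<forall>j<k. digit_sum d j \<noteq> n) \<longleftrightarrow> evil n d \<and> evil_location n d = k"
proof
  assume "digit_sum d k = n \<and> (\<forall>j<k. digit_sum d j \<noteq> n)"
  thus "evil n d \<and> evil_location n d = k"
    unfolding evil_def evil_location_def by (auto intro!: Least_equality simp: not_less[symmetric])
next
  assume *: "evil n d \<and> evil_location n d = k"
  thus "digit_sum d k = n \<and> (\<forall>j<k. digit_sum d j \<noteq> n)"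
    unfolding evil_def evil_location_def by (metis (mono_tags, lifting) LeastI not_less_Least)
qed

lemma first_hit_prob_sums:
  "first_hit_prob b n sums measure (digits b) {d \<in> space (digits b). evil n d}"
proof -
  interpret D: prob_space "digits b" by (rule prob_space_digits)
  let ?F = "\<lambda>k. {d \<in> space (digits b). evil n d \<and> evil_location n d = k}"
  have "(\<lambda>k. measure (digits b) (?F k)) sums measure (digits b) (\<Union>k. ?F k)"
    by (intro D.finite_measure_UNION) (auto simp: disjoint_family_on_def)
  moreover have "(\<Union>k. ?F k) = {d \<in> space (digits b). evil n d}" by auto
  moreover have "(\<lambda>k. measure (digits b) (?F k)) = first_hit_prob b n"
    by (simp add: first_hit_prob_def first_hit_iff fun_eq_iff)
  ultimately show ?thesis by simp
qed

lemma evil_location_law: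
  assumes "b \<ge> 2"
  shows "measure (evil_digits b n) {d \<in> space (evil_digits b n). evil_location n d = k} =
           first_hit_prob b n k / (\<Sum>j. first_hit_prob b n j)"
proof -
  interpret D: prob_space "digits b" by (rule prob_space_digits)
  let ?E = "{d \<in> space (digits b). evil n d}"
  let ?L = "{d \<in> space (digits b). evil_location n d = k}"
  have "measure (evil_digits b n) ?L = measure (digits b) (?E \<inter> ?L) / measure (digits b) ?E"
    unfolding evil_digits_def using evil_prob_pos[OF assms, of n]
    by (intro measure_uniform_measure) (auto simp: D.emeasure_eq_measure)
  moreover have "?E \<inter> ?L = {d \<in> space (digits b). evil n d \<and> evil_location n d = k}" by auto
  moreover have "space (evil_digits b n) = space (digits b)" by (simp add: evil_digits_def)
  moreover have "first_hit_prob b n k =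
      measure (digits b) {d \<in> space (digits b). evil n d \<and> evil_location n d = k}"
    by (simp add: first_hit_prob_def first_hit_iff)
  ultimately show ?thesis
    using sums_unique[OF first_hit_prob_sums[of b n]] by simp
qed

end

theory Submission
  imports Defs "HOL-Complex_Analysis.Complex_Analysis"
begin

text \<open>
  Let \<open>D(x) = (1 + x + ... + x^(b-1)) / b\<close> be the generating function of one uniform digit and
  \<open>c k = [x^n] D(x)^k\<close>. For \<open>n > 0\<close> the location of \<open>n\<close> is \<open>k\<close> exactly when the \<open>k\<close>-th partial
  sum is \<open>n\<close> and the \<open>k\<close>-th digit is not \<open>0\<close>. Since the first digit is a uniform digit
  conditioned on not being \<open>0\<close>, inclusion-exclusion over a leading and a trailing zero gives
  (\<open>first_hit_prob_digit_gf\<close>)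

    \<open>P(location = k) = (b^2 * c k - 2 * b * c (k - 1) + c (k - 2)) / (b * (b - 1))\<close>.

  Hence the sum of \<open>f(k) P(location = k)\<close> over \<open>k\<close> is, for a polynomial \<open>f\<close>, a linear
  combination of the sums of \<open>binomial(k + m, m) * c k\<close>, and each of these is the coefficient of
  \<open>x^n\<close> in \<open>(1 / (1 - D(x)))^(m + 1)\<close> (\<open>rising_poly_digit_series\<close>).

  In the closed unit disc \<open>1 - D(x)\<close> vanishes only at \<open>x = 1\<close>, and there to first order. So the
  power \<open>(1 / (1 - D))^m\<close> differs from its principal part at \<open>1\<close> by a function that is
  holomorphic in a larger disc. The principal part contributes a polynomial in \<open>n\<close> to the
  coefficients and the rest an exponentially small error (\<open>digit_resolvent_expansion\<close>). Thus
  every moment, after division by the probability \<open>2 / b + O(\<alpha>^n)\<close> of being \<open>n\<close>-evil, is a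
  polynomial in \<open>n\<close> up to an exponentially small error, and so is every central moment, because
  sequences of this kind form a ring (\<open>asymp_poly\<close>).

  It remains to identify the polynomials up to order five. This takes the first six Taylor
  coefficients at \<open>1\<close> of the powers of \<open>(1 - x) / (1 - D(x))\<close>; after that, both the raw moments
  (\<open>hit_moment_asymptotics\<close>) and the passage to central moments (\<open>evil_central_moment_asymp\<close>)
  are polynomial identities in \<open>b\<close> and \<open>n\<close>. The limits of the scaled moments compare leading
  coefficients.
\<close>

section \<open>Exponentially small sequences\<close>

definition exp_small :: "(nat \<Rightarrow> real) \<Rightarrow> bool" where
  "exp_small f \<longleftrightarrow>
    (\<exists>\<alpha>::real. 0 < \<alpha> \<and> \<alpha> < 1 \<and> f \<in> O(\<lambda>n. \<alpha> ^ n))"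

lemma power_in_bigo_power:
  fixes \<alpha> \<beta> :: real
  assumes "0 < \<alpha>" "\<alpha> \<le> \<beta>"
  shows "(\<lambda>n. \<alpha> ^ n) \<in> O(\<lambda>n. \<beta> ^ n)"
  using assms by (intro bigoI[of _ 1] always_eventually) (auto simp: power_mono)

lemma exp_small_obtain:
  assumes "exp_small f"
  obtains \<alpha> :: real where "0 < \<alpha>" "\<alpha> < 1" "\<And>\<beta>. \<alpha>
    \<le> \<beta> \<Longrightarrow> f \<in> O(\<lambda>n. \<beta> ^ n)"
  using assms landau_o.big_trans[OF _ power_in_bigo_power] unfolding exp_small_def by metis

lemma exp_small_common_rate:
  assumes "finite F" "\<And>f. f \<in> F \<Longrightarrow> exp_small f"
  shows "\<exists>\<alpha>::real. 0 < \<alpha> \<and> \<alpha> < 1 \<and>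
    (\<forall>f\<in>F. f \<in> O(\<lambda>n. \<alpha> ^ n))"
  using assms
proof (induction F)
  case empty
  show ?case by (intro exI[of _ "1/2"]) auto
next
  case (insert f F)
  then obtain \<alpha> where \<alpha>: "0 < \<alpha>" "\<alpha> < 1" "\<forall>f\<in>F. f \<in> O(\<lambda>n. \<alpha> ^ n)" by auto
  obtain \<beta> where \<beta>: "0 < \<beta>" "\<beta> < 1" "\<And>\<gamma>. \<beta>
    \<le> \<gamma> \<Longrightarrow> f \<in> O(\<lambda>n. \<gamma> ^ n)"
    using exp_small_obtain[of f] insert by auto
  have "g \<in> O(\<lambda>n. max \<alpha> \<beta> ^ n)" if "g \<in> F" for g
    using landau_o.big_trans[OF bspec[OF \<alpha>(3) that] power_in_bigo_power[of \<alpha> "max \<alpha> \<beta>"]] \<alpha>(1) by simp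
  with \<alpha> \<beta> show ?case by (intro exI[of _ "max \<alpha> \<beta>"]) auto
qed

lemma exp_small_zero: "exp_small (\<lambda>_. 0)"
  unfolding exp_small_def by (intro exI[of _ "1/2"]) auto

lemma exp_small_add:
  assumes "exp_small f" "exp_small g"
  shows "exp_small (\<lambda>n. f n + g n)"
proof -
  obtain \<alpha> where \<alpha>: "0 < \<alpha>" "\<alpha> < 1" "\<And>\<beta>. \<alpha>
    \<le> \<beta> \<Longrightarrow> f \<in> O(\<lambda>n. \<beta> ^ n)"
    using exp_small_obtain[OF assms(1)] by blast
  obtain \<gamma> where \<gamma>: "0 < \<gamma>" "\<gamma> < 1" "\<And>\<beta>. \<gamma>
    \<le> \<beta> \<Longrightarrow> g \<in> O(\<lambda>n. \<beta> ^ n)"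
    using exp_small_obtain[OF assms(2)] by blast
  show ?thesis
    unfolding exp_small_def using \<alpha> \<gamma>
    by (intro exI[of _ "max \<alpha> \<gamma>"] conjI sum_in_bigo) auto
qed

lemma exp_small_mult_bounded:
  assumes "exp_small f" "g \<in> O(\<lambda>_. 1)"
  shows "exp_small (\<lambda>n. g n * f n)"
  using assms landau_o.big.mult[of g _ "\<lambda>_. 1" f] unfolding exp_small_def by fastforce

lemma exp_small_cmult: "exp_small f \<Longrightarrow> exp_small (\<lambda>n. c * f n)"
  by (rule exp_small_mult_bounded) auto

lemma exp_small_imp_bounded:
  assumes "exp_small f"
  shows "f \<in> O(\<lambda>_. 1)"
proof -
  obtain \<alpha> where \<alpha>: "0 < \<alpha>" "\<alpha> < 1" "f \<in> O(\<lambda>n. \<alpha> ^ n)"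
    using assms unfolding exp_small_def by blast
  then show ?thesis
    using landau_o.big_trans[OF \<alpha>(3) power_in_bigo_power[of \<alpha> 1]] by simp
qed

lemma exp_small_mult: "exp_small f \<Longrightarrow> exp_small g \<Longrightarrow> exp_small
  (\<lambda>n. f n * g n)"
  by (intro exp_small_mult_bounded exp_small_imp_bounded)

lemma exp_small_sum:
  "(\<And>i. i \<in> A \<Longrightarrow> exp_small (f i)) \<Longrightarrow> exp_small
    (\<lambda>n. \<Sum>i\<in>A. f i n)"
proof (induction A rule: infinite_finite_induct)
  case (insert x A)
  then have "exp_small (f x)" "exp_small (\<lambda>n. \<Sum>i\<in>A. f i n)" by blast+
  from exp_small_add[OF this] insert show ?case by simp
qed (simp_all add: exp_small_zero)

lemma exp_small_cong:
  assumes "eventually (\<lambda>n. f n = g n) sequentially"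
  shows "exp_small f \<longleftrightarrow> exp_small g"
  unfolding exp_small_def using landau_o.big.in_cong[OF assms] by simp

lemma exp_small_tendsto_0:
  assumes "exp_small f"
  shows "f \<longlonglongrightarrow> 0"
proof -
  obtain \<alpha> where "0 < \<alpha>" "\<alpha> < 1" "f \<in> O(\<lambda>n. \<alpha> ^ n)"
    using assms unfolding exp_small_def by blast
  moreover have "(\<lambda>n. \<alpha> ^ n) \<longlonglongrightarrow> 0" using calculation
    by (intro LIMSEQ_power_zero) auto
  then have "(\<lambda>n. \<alpha> ^ n) \<in> o(\<lambda>_. 1)" by (intro smalloI_tendsto) auto
  ultimately have "f \<in> o(\<lambda>_. 1)" by (auto intro: landau_o.big_small_trans)
  then show ?thesis using smalloD_tendsto by fastforce
qed

lemma exp_small_summable: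
  assumes "exp_small f"
  shows "summable (\<lambda>n. norm (f n))"
proof -
  obtain \<alpha> where \<alpha>: "0 < \<alpha>" "\<alpha> < 1" "f \<in> O(\<lambda>n. \<alpha> ^ n)"
    using assms unfolding exp_small_def by blast
  then have "summable (\<lambda>n. norm (\<alpha> ^ n))" by (simp add: norm_power)
  moreover have "(\<lambda>n. norm (f n)) \<in> O(\<lambda>n. \<alpha> ^ n)" using \<alpha>(3) by simp
  ultimately show ?thesis
    by (rule summable_comparison_test_bigo)
qed

text \<open>
  The factor \<open>n\<close> is absorbed by passing from the rate \<open>\<alpha>\<close> to the larger rate \<open>sqrt \<alpha>\<close>.
\<close>

lemma exp_small_index_mult:
  assumes "exp_small f"
  shows "exp_small (\<lambda>n. real n * f n)"
proof -
  obtain \<alpha> where \<alpha>: "0 < \<alpha>" "\<alpha> < 1" "f \<in> O(\<lambda>n. \<alpha> ^ n)"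
    using assms unfolding exp_small_def by blast
  define \<beta> where "\<beta> = sqrt \<alpha>"
  have \<beta>: "0 < \<beta>" "\<beta> < 1" "\<beta> * \<beta> = \<alpha>" using \<alpha>
    by (auto simp: \<beta>_def)
  have "(\<lambda>n. real n * \<beta> ^ n) \<longlonglongrightarrow> 0"
    using \<beta> by (intro powser_times_n_limit_0) auto
  then have "(\<lambda>n. real n * \<beta> ^ n) \<in> O(\<lambda>_. 1)"
    by (intro bigoI_tendsto[where c = 0]) auto
  from landau_o.big.mult[OF this landau_o.big_refl[of "\<lambda>n. \<beta> ^ n"]]
  have "(\<lambda>n. real n * \<alpha> ^ n) \<in> O(\<lambda>n. \<beta> ^ n)"
    by (simp flip: \<beta>(3) add: power_mult_distrib mult_ac)
  moreover have "(\<lambda>n. real n * f n) \<in> O(\<lambda>n. real n * \<alpha> ^ n)"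
    using \<alpha> by (intro landau_o.big.mult_left)
  ultimately have "(\<lambda>n. real n * f n) \<in> O(\<lambda>n. \<beta> ^ n)"
    by (rule landau_o.big_trans[rotated])
  then show ?thesis
    unfolding exp_small_def using \<beta>(1,2) by blast
qed

lemma exp_small_poly_mult:
  assumes "exp_small f"
  shows "exp_small (\<lambda>n. poly p (real n) * f n)"
proof (induction p)
  case 0
  show ?case using exp_small_cmult[OF assms, of 0] by simp
next
  case (pCons a p)
  then show ?case
    using exp_small_add[OF exp_small_cmult[OF assms, of a] exp_small_index_mult[OF pCons(2)]]
    by (simp only: poly_pCons distrib_right mult.assoc)
qed

text \<open>
  This turns closure of exponentially small sequences under convolution and inversion into
  statements about radii of convergence.
\<close>

lemma exp_small_iff_conv_radius: "exp_small f \<longleftrightarrow> conv_radius f > 1"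
proof
  assume "exp_small f"
  then obtain \<alpha> where \<alpha>: "0 < \<alpha>" "\<alpha> < 1" "f \<in> O(\<lambda>n. \<alpha> ^ n)"
    unfolding exp_small_def by blast
  have "conv_radius f \<ge> ereal (1 / \<alpha>)"
  proof (rule conv_radius_geI_ex')
    fix r :: real assume r: "0 < r" "ereal r < ereal (1 / \<alpha>)"
    have "(\<lambda>n. f n * r ^ n) \<in> O(\<lambda>n. \<alpha> ^ n * r ^ n)"
      using \<alpha> by (intro landau_o.big.mult_right)
    moreover have "summable (\<lambda>n. norm (\<alpha> ^ n * r ^ n))"
    proof -
      have "\<alpha> * r < 1" "0 < \<alpha> * r" using \<alpha> r
        by (simp_all add: pos_less_divide_eq mult.commute)
      then have "summable (\<lambda>n. (\<alpha> * r) ^ n)" by (intro summable_geometric) simp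
      moreover have "norm (\<alpha> ^ n * r ^ n) = (\<alpha> * r) ^ n" for n
        unfolding power_mult_distrib[symmetric] real_norm_def using \<open>0 < \<alpha> * r\<close>
        by (intro abs_of_pos zero_less_power)
      ultimately show ?thesis by presburger
    qed
    ultimately have "summable (\<lambda>n. f n * r ^ n)"
      by (rule summable_comparison_test_bigo[rotated])
    then show "summable (\<lambda>n. f n * of_real r ^ n)" by simp
  qed
  moreover have "1 < ereal (1 / \<alpha>)" using \<alpha> by (simp add: one_ereal_def)
  ultimately show "conv_radius f > 1"
    by (rule less_le_trans[rotated])
next
  assume "conv_radius f > 1"
  then obtain r where r: "1 < r" "ereal r < conv_radius f"
    using ereal_dense2[of 1 "conv_radius f"] unfolding one_ereal_def ereal_less_eq less_ereal.simps by blast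
  then have "summable (\<lambda>n. f n * r ^ n)"
    by (intro summable_in_conv_radius) auto
  then have "(\<lambda>n. f n * r ^ n) \<in> O(\<lambda>_. 1)"
    by (intro bigoI_tendsto[where c = 0]) (simp_all add: summable_LIMSEQ_zero)
  from landau_o.big.mult[OF this landau_o.big_refl[of "\<lambda>n. (1 / r) ^ n"]]
  have "f \<in> O(\<lambda>n. (1 / r) ^ n)" using r by (simp add: power_divide)
  then show "exp_small f"
    unfolding exp_small_def using r by (intro exI[of _ "1 / r"]) auto
qed

section \<open>Power series whose coefficients decay exponentially\<close>

abbreviation decaying :: "real fps \<Rightarrow> bool" where
  "decaying F \<equiv> exp_small (fps_nth F)"

lemma decaying_iff: "decaying F \<longleftrightarrow> fps_conv_radius F > 1"
  by (simp add: exp_small_iff_conv_radius fps_conv_radius_def)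

lemma decaying_add: "decaying F \<Longrightarrow> decaying G \<Longrightarrow> decaying (F + G)"
  by (drule (1) exp_small_add) (simp flip: fps_add_nth)

lemma decaying_mult: "decaying F \<Longrightarrow> decaying G \<Longrightarrow> decaying (F * G)"
  unfolding decaying_iff using fps_conv_radius_mult[of F G] by (meson less_le_trans min_less_iff_conj)

lemma decaying_of_poly: "decaying (fps_of_poly p)"
  by (simp add: decaying_iff)

text \<open>
  A polynomial has finitely many roots, so having none in the closed unit disc it has none in
  some larger disc; its reciprocal is holomorphic there.
\<close>

lemma decaying_inverse_of_poly:
  fixes p :: "real poly"
  assumes "\<And>z::complex. norm z \<le> 1 \<Longrightarrow> poly (map_poly of_real p) z \<noteq> 0"
  shows "decaying (inverse (fps_of_poly p))"
proof -
  let ?q = "map_poly of_real p :: complex poly"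
  have nz: "?q \<noteq> 0" using assms[of 0] by auto
  have "\<exists>r>1. \<forall>z. norm z < r \<longrightarrow> poly ?q z \<noteq> 0"
  proof -
    define r where "r = Min (insert 2 (norm ` {z. poly ?q z = 0}))"
    have fin: "finite {z. poly ?q z = 0}" using nz by (rule poly_roots_finite)
    have "norm z > 1" if "poly ?q z = 0" for z using assms[of z] that by linarith
    then have "r > 1" using fin by (auto simp: r_def)
    moreover have "r \<le> norm z" if "poly ?q z = 0" for z using that fin by (auto simp: r_def)
    ultimately show ?thesis using not_le by blast
  qed
  then obtain r where r: "r > 1" "\<And>z. norm z < r \<Longrightarrow> poly ?q z \<noteq> 0" by blast
  have "min (ereal r) (fps_conv_radius (fps_of_poly ?q)) \<le> fps_conv_radius (inverse (fps_of_poly ?q))"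
    using r(2) by (intro fps_conv_radius_inverse) simp
  then have radius: "fps_conv_radius (inverse (fps_of_poly ?q)) > 1"
    using r(1) less_le_trans[of 1 "ereal r"] by (simp add: one_ereal_def)
  have p0: "coeff p 0 \<noteq> 0"
    using assms[of 0] by (simp add: poly_0_coeff_0 coeff_map_poly)
  let ?I = "Abs_fps (\<lambda>n. complex_of_real (fps_nth (inverse (fps_of_poly p)) n))"
  have inv: "fps_of_poly p * inverse (fps_of_poly p) = 1"
    using p0 by (simp add: inverse_mult_eq_1')
  have "fps_of_poly ?q * ?I = 1"
  proof (rule fps_ext)
    fix n
    have "fps_nth (fps_of_poly ?q * ?I) n = of_real (fps_nth (fps_of_poly p * inverse (fps_of_poly p)) n)"
      by (simp add: fps_mult_nth coeff_map_poly)
    then show "fps_nth (fps_of_poly ?q * ?I) n = fps_nth 1 n"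
      unfolding inv by simp
  qed
  then have "inverse (fps_of_poly ?q) = ?I"
    by (rule fps_inverse_unique)
  moreover have "conv_radius (\<lambda>n. complex_of_real (fps_nth (inverse (fps_of_poly p)) n)) =
      conv_radius (fps_nth (inverse (fps_of_poly p)))"
    using conv_radius_norm[of "\<lambda>n. complex_of_real (fps_nth (inverse (fps_of_poly p)) n)"]
      conv_radius_norm[of "fps_nth (inverse (fps_of_poly p))"]
    by (simp del: conv_radius_norm)
  ultimately show ?thesis
    using radius by (simp add: decaying_iff fps_conv_radius_def)
qed

section \<open>Taylor expansions at the point one\<close>

text \<open>
  Polynomials \<open>p\<close> in the local coordinate \<open>y = 1 - x\<close>, read as power series in \<open>x\<close>.
\<close>

abbreviation at_one :: "real poly \<Rightarrow> real fps" where
  "at_one p \<equiv> fps_of_poly (pcompose p [:1, -1:])"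

lemma pcompose_power: "pcompose (p ^ n) r = pcompose p r ^ n"
  by (induction n) (simp_all add: pcompose_1 pcompose_mult)

lemma fps_of_poly_one_minus_X: "fps_of_poly [:1, -1:] = (1 - fps_X :: real fps)"
  by (simp add: fps_of_poly_pCons)

lemma at_one_add: "at_one (p + q) = at_one p + at_one q"
  by (simp add: pcompose_add fps_of_poly_add)

lemma at_one_mult: "at_one (p * q) = at_one p * at_one q"
  by (simp add: pcompose_mult fps_of_poly_mult)

lemma at_one_monom: "at_one (monom c j) = fps_const c * (1 - fps_X) ^ j"
proof -
  have "monom c j = smult c ([:0, 1:] ^ j)"
    by (simp add: monom_altdef)
  then show ?thesis
    by (simp add: pcompose_smult pcompose_power fps_of_poly_smult fps_of_poly_power fps_of_poly_one_minus_X pcompose_pCons)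
qed

lemma decaying_one_minus_X_power: "decaying ((1 - fps_X) ^ N)"
  using decaying_of_poly[of "[:1, -1:] ^ N"] by (simp add: fps_of_poly_power fps_of_poly_one_minus_X)

text \<open>
  The series \<open>v\<close>, in the coordinate \<open>y = 1 - x\<close>, is the Taylor series of \<open>F\<close> at \<open>x = 1\<close>, and \<open>F\<close>
  is holomorphic in a neighbourhood of the closed unit disc: after any number of terms the
  remainder is divisible by the next power of \<open>y\<close> with a decaying quotient. A formal power
  series in \<open>x\<close> cannot be re-expanded at \<open>1\<close>, so the expansion is expressed by polynomials that
  agree with \<open>v\<close> up to a given order; that \<open>p\<close> may have further terms makes products immediate.
\<close>

definition expands_at_one :: "real fps \<Rightarrow> real fps \<Rightarrow> bool" where
  "expands_at_one F v \<longleftrightarrow> (\<forall>N. \<exists>p E. (\<forall>k<N. coeff p k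
    = fps_nth v k) \<and> decaying E \<and>
     F = at_one p + (1 - fps_X) ^ N * E)"

lemma expands_at_one_1: "expands_at_one 1 1"
  unfolding expands_at_one_def
  using decaying_of_poly[of 0]
    by (intro allI exI[of _ 1] exI[of _ 0]) (simp add: pcompose_1 coeff_1 fps_one_nth)

lemma expands_at_one_mult:
  assumes "expands_at_one F v" "expands_at_one G w"
  shows "expands_at_one (F * G) (v * w)"
  unfolding expands_at_one_def
proof
  fix N
  obtain p E where p: "\<forall>k<N. coeff p k = fps_nth v k" "decaying E" "F = at_one p + (1 - fps_X) ^ N * E"
    using assms(1) unfolding expands_at_one_def by blast
  obtain q E' where q: "\<forall>k<N. coeff q k = fps_nth w k" "decaying E'" "G = at_one q + (1
    - fps_X) ^ N * E'"
    using assms(2) unfolding expands_at_one_def by blast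
  let ?E = "E * at_one q + at_one p * E' + (1 - fps_X) ^ N * (E * E')"
  have "\<forall>k<N. coeff (p * q) k = fps_nth (v * w) k"
    using p(1) q(1) by (auto simp: coeff_mult fps_mult_nth atLeast0AtMost intro!: sum.cong)
  moreover have "decaying ?E"
    by (intro decaying_add decaying_mult decaying_of_poly decaying_one_minus_X_power p q)
  moreover have "F * G = at_one (p * q) + (1 - fps_X) ^ N * ?E"
    unfolding p(3) q(3) at_one_mult by (simp add: algebra_simps)
  ultimately show "\<exists>p E. (\<forall>k<N. coeff p k = fps_nth (v * w) k) \<and> decaying E \<and>
      F * G = at_one p + (1 - fps_X) ^ N * E"
    by blast
qed

lemma expands_at_one_power: "expands_at_one F v \<Longrightarrow> expands_at_one (F ^ m) (v ^ m)"
  by (induction m) (simp_all add: expands_at_one_1 expands_at_one_mult)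

text \<open>
  Let \<open>q\<close> be the truncation of \<open>1 / p\<close> to order \<open>N\<close>. Then \<open>p * q = 1 + y^N * R\<close>, and dividing by
  \<open>p\<close> shows that \<open>q\<close> approximates \<open>1 / p\<close> with remainder \<open>- y^N * R / p\<close>.
\<close>

lemma expands_at_one_inverse_of_poly:
  assumes "coeff p 0 \<noteq> 0" and dec: "decaying (inverse (at_one p))" and nz: "fps_nth
    (at_one p) 0 \<noteq> 0"
  shows "expands_at_one (inverse (at_one p)) (inverse (fps_of_poly p))"
  unfolding expands_at_one_def
proof
  fix N
  let ?w = "inverse (fps_of_poly p)"
  define q where "q = (\<Sum>j<N. monom (fps_nth ?w j) j)"
  have q: "coeff q k = fps_nth ?w k" if "k < N" for k
    using that by (simp add: q_def coeff_sum if_distrib cong: if_cong)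
  have "coeff (p * q) k = coeff 1 k" if "k < N" for k
  proof -
    have "coeff (p * q) k = fps_nth (fps_of_poly p * ?w) k"
      using that q by (auto simp: coeff_mult fps_mult_nth atLeast0AtMost intro!: sum.cong)
    also have "fps_of_poly p * ?w = 1" using assms(1) by (simp add: inverse_mult_eq_1')
    finally show ?thesis by (simp add: fps_one_nth coeff_1)
  qed
  then have "monom 1 N dvd p * q - 1"
    by (simp add: monom_1_dvd_iff')
  then obtain R where R: "p * q = 1 + monom 1 N * R"
    by (auto simp: dvd_def algebra_simps)
  have "at_one p * at_one q = 1 + (1 - fps_X) ^ N * at_one R"
    unfolding at_one_mult[symmetric] R by (simp add: at_one_add at_one_mult at_one_monom pcompose_1)
  moreover have "at_one q = inverse (at_one p) * (at_one p * at_one q)"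
    unfolding mult.assoc[symmetric] using inverse_mult_eq_1[OF nz] by simp
  ultimately have "at_one q = inverse (at_one p) * (1 + (1 - fps_X) ^ N * at_one R)"
    by (simp only:)
  then have "inverse (at_one p) = at_one q + (1 - fps_X) ^ N * (inverse (at_one p) * at_one (- R))"
    by (simp add: pcompose_uminus fps_of_poly_uminus distrib_left mult.left_commute)
  moreover have "decaying (inverse (at_one p) * at_one (- R))"
    by (intro decaying_mult dec decaying_of_poly)
  ultimately show "\<exists>q E. (\<forall>k<N. coeff q k = fps_nth ?w k) \<and> decaying E \<and>
      inverse (at_one p) = at_one q + (1 - fps_X) ^ N * E"
    using q by blast
qed

text \<open>
  Coefficients of \<open>F / (1 - x)^m\<close>: the terms of the Taylor expansion of \<open>F\<close> of order below \<open>m\<close>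
  form the principal part at \<open>1\<close>, whose coefficients are binomial by the negative binomial
  series. What is left is decaying.
\<close>

lemma pole_coefficients:
  assumes "expands_at_one F v"
  shows "exp_small (\<lambda>n. fps_nth (inverse ((1 - fps_X) ^ m) * F) n
     - (\<Sum>j<m. fps_nth v j * real ((n + (m - 1 - j)) choose (m - 1 - j))))"
proof -
  obtain p E where p: "\<forall>k<m. coeff p k = fps_nth v k" "decaying E" "F = at_one p + (1 - fps_X) ^ m * E"
    using assms unfolding expands_at_one_def by blast
  have "monom 1 m dvd p - (\<Sum>j<m. monom (fps_nth v j) j)"
    unfolding monom_1_dvd_iff' using p(1) by (simp add: coeff_sum if_distrib cong: if_cong)
  then obtain R where R: "p = (\<Sum>j<m. monom (fps_nth v j) j) + monom 1 m * R"
    by (auto simp: dvd_def algebra_simps)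
  let ?I = "\<lambda>m. inverse ((1 - fps_X) ^ m) :: real fps"
  have canc: "?I m * ((1 - fps_X) ^ m * G) = G" for G
  proof -
    have "?I m * (1 - fps_X) ^ m = 1" by (rule inverse_mult_eq_1) simp
    then show ?thesis by (simp flip: mult.assoc)
  qed
  have canc': "?I m * (1 - fps_X) ^ j = ?I (m - j)" if "j < m" for j
  proof -
    have "?I m = ?I (m - j) * ?I j"
      using that by (simp flip: fps_inverse_mult power_add)
    moreover have "?I j * (1 - fps_X) ^ j = 1" by (rule inverse_mult_eq_1) simp
    ultimately show ?thesis by (simp add: mult.assoc)
  qed
  have "at_one p = (\<Sum>j<m. fps_const (fps_nth v j) * (1 - fps_X) ^ j) + (1 - fps_X) ^ m * at_one R"
    unfolding R at_one_add at_one_mult pcompose_sum fps_of_poly_sum at_one_monom by simp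
  then have "F = (\<Sum>j<m. fps_const (fps_nth v j) * (1 - fps_X) ^ j) + (1 - fps_X) ^ m * (at_one R + E)"
    unfolding p(3) by (simp add: distrib_left)
  then have "?I m * F = ?I m * (\<Sum>j<m. fps_const (fps_nth v j) * (1 - fps_X) ^ j) + (at_one R + E)"
    by (simp only: distrib_left canc)
  also have "?I m * (\<Sum>j<m. fps_const (fps_nth v j) * (1 - fps_X) ^ j) =
      (\<Sum>j<m. fps_const (fps_nth v j) * ?I (m - j))"
    unfolding sum_distrib_left using canc'
    by (intro sum.cong refl) (simp add: mult.left_commute[of "?I m"])
  finally have "?I m * F = (\<Sum>j<m. fps_const (fps_nth v j) * ?I (m - j)) + (at_one R + E)" .
  moreover have "fps_nth (fps_const (fps_nth v j) * ?I (m - j)) n =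
      fps_nth v j * real ((n + (m - 1 - j)) choose (m - 1 - j))" if "j < m" for n j
  proof -
    have "fps_nth (?I (m - j)) n = real ((m - j + n - 1) choose n)"
      using one_minus_const_fps_X_neg_power'[of "m - j" "1::real"] that by simp
    also have "m - j + n - 1 = n + (m - 1 - j)" using that by simp
    also have "real ((n + (m - 1 - j)) choose n) = real ((n + (m - 1 - j)) choose (m - 1 - j))"
      by (subst binomial_symmetric) auto
    finally show ?thesis by simp
  qed
  ultimately have "fps_nth (?I m * F) n - (\<Sum>j<m. fps_nth v j * real ((n + (m - 1 - j)) choose (m - 1 - j)))
      = fps_nth (at_one R + E) n" for n
    by (simp add: fps_sum_nth del: fps_mult_left_const_nth)
  then have "(\<lambda>n. fps_nth (?I m * F) n - (\<Sum>j<m. fps_nth v j * real ((n + (m - 1 - j)) choose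
    (m - 1 - j))))
      = fps_nth (at_one R + E)"
    by (rule ext)
  then show ?thesis
    using decaying_add[OF decaying_of_poly p(2)] by (simp only:)
qed

section \<open>The distribution of the evil location\<close>

lemma indep_vars_digits:
  "prob_space.indep_vars (digits b) (\<lambda>_. borel) (\<lambda>j d. real (d j)) {1..}"
proof -
  interpret product_prob_space "\<lambda>j. measure_pmf (digit_pmf b j)" "{1..}"
    by standard
  interpret D: prob_space "digits b" by (rule prob_space_digits)
  have comp: "(\<lambda>d. d j) \<in> measurable (digits b) (measure_pmf (digit_pmf b j))"
    if "j \<in> {1..}" for j
    unfolding digits_def using that by (intro measurable_component_singleton) auto
  have "D.indep_vars (\<lambda>j. measure_pmf (digit_pmf b j)) (\<lambda>j d. d j) {1..}"
  proof (subst D.indep_vars_iff_distr_eq_PiM')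
    have "distr (digits b) (PiM {1..} (\<lambda>j. measure_pmf (digit_pmf b j)))
      (\<lambda>d. \<lambda>j\<in>{1..}. d j)
        = distr (digits b) (digits b) (\<lambda>d. d)"
      by (intro distr_cong) (auto simp: digits_def space_PiM PiE_def extensional_def fun_eq_iff)
    also have "\<dots> = PiM {1..} (\<lambda>j. measure_pmf (digit_pmf b j))"
      by (simp add: digits_def)
    also have "\<dots> = PiM {1..} (\<lambda>j. distr (digits b) (measure_pmf (digit_pmf b j))
      (\<lambda>d. d j))"
    proof (intro PiM_cong refl)
      fix j :: nat assume "j \<in> {1..}"
      from PiM_component[OF this]
      show "measure_pmf (digit_pmf b j) = distr (digits b) (measure_pmf (digit_pmf b j)) (\<lambda>d. d j)"
        by (simp add: digits_def)
    qed
    finally show "distr (digits b) (PiM {1..} (\<lambda>j. measure_pmf (digit_pmf b j)))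
      (\<lambda>d. \<lambda>j\<in>{1..}. d j)
      = PiM {1..} (\<lambda>j. distr (digits b) (measure_pmf (digit_pmf b j)) (\<lambda>d. d j))" .
  qed (use comp in auto)
  then show ?thesis
    by (rule D.indep_vars_compose2[where Y = "\<lambda>_ i. real i"]) simp
qed

text \<open>
  The partial sum after \<open>k\<close> digits depends on the first \<open>k\<close> digits only.
\<close>

lemma prob_next_digit:
  "measure (digits b) {d \<in> space (digits b). digit_sum d k = m \<and> d (Suc k) = i} =
     measure (digits b) {d \<in> space (digits b). digit_sum d k = m} * pmf (digit_pmf b (Suc k)) i"
proof -
  interpret product_prob_space "\<lambda>j. measure_pmf (digit_pmf b j)" "{1..}"
    by standard
  interpret D: prob_space "digits b" by (rule prob_space_digits)
  have "D.indep_var borel (\<lambda>d. real (d (Suc k))) borel (\<lambda>d. \<Sum>j\<in>{1..k}. real (d j))"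
    by (intro D.indep_vars_sum D.indep_vars_subset[OF indep_vars_digits]) auto
  from D.prob_indep_random_variable[OF this, of "{real i}" "{real m}"]
  have "D.prob {d \<in> space (digits b). real (d (Suc k)) = real i \<and> (\<Sum>j\<in>{1..k}. real
    (d j)) = real m}
      = D.prob {d \<in> space (digits b). d (Suc k) = i} *
        D.prob {d \<in> space (digits b). (\<Sum>j\<in>{1..k}. real (d j)) = real m}"
    by simp
  moreover have "(\<Sum>j\<in>{1..k}. real (d j)) = real m \<longleftrightarrow> digit_sum d k = m" for d
    unfolding digit_sum_def of_nat_sum[symmetric] of_nat_eq_iff ..
  moreover have "D.prob {d \<in> space (digits b). d (Suc k) = i} = pmf (digit_pmf b (Suc k)) i"
  proof -
    have "emeasure (digits b) {d \<in> space (digits b). d (Suc k) \<in> {i}} =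
        emeasure (measure_pmf (digit_pmf b (Suc k))) {i}"
      unfolding digits_def by (rule emeasure_PiM_Collect_single) auto
    then show ?thesis
      by (simp add: D.emeasure_eq_measure measure_pmf.emeasure_eq_measure measure_pmf_single)
  qed
  ultimately show ?thesis by (simp add: conj_commute mult.commute)
qed

text \<open>
  With \<open>M = n + 1\<close> the restriction on the previous partial sum is void, and this computes the
  law of the next partial sum. With \<open>M = n\<close> the partial sums reach \<open>n\<close> for the first time.
\<close>

lemma prob_digit_sum_step_below:
  assumes "M \<le> Suc n"
  shows "measure (digits b) {d \<in> space (digits b). digit_sum d (Suc k) = n \<and> digit_sum d k < M} =
    (\<Sum>m<M. measure (digits b) {d \<in> space (digits b). digit_sum d k = m} *
       pmf (digit_pmf b (Suc k)) (n - m))"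
proof -
  interpret D: prob_space "digits b" by (rule prob_space_digits)
  have S: "digit_sum d (Suc k) = digit_sum d k + d (Suc k)" for d
    by (simp add: digit_sum_def)
  have m: "(\<lambda>d. d (Suc k)) \<in> measurable (digits b) (count_space UNIV)"
  proof -
    have "(\<lambda>d. d (Suc k)) \<in> measurable (digits b) (measure_pmf (digit_pmf b (Suc k)))"
      unfolding digits_def by (intro measurable_component_singleton) auto
    then show ?thesis by simp
  qed
  have "{d \<in> space (digits b). digit_sum d (Suc k) = n \<and> digit_sum d k < M} =
      (\<Union>m\<in>{..<M}. {d \<in> space (digits b). digit_sum d k = m \<and> d (Suc k) = n - m})"
    using assms by (auto simp: S)
  moreover have "D.prob (\<Union>m\<in>{..<M}. {d \<in> space (digits b). digit_sum d k = m \<and> d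
    (Suc k) = n - m}) =
      (\<Sum>m\<in>{..<M}. D.prob {d \<in> space (digits b). digit_sum d k = m \<and> d (Suc k) = n - m})"
    using m by (intro D.finite_measure_finite_Union) (auto simp: disjoint_family_on_def)
  ultimately show ?thesis by (simp add: prob_next_digit)
qed

definition digit_gf :: "nat \<Rightarrow> real fps" where
  "digit_gf b = Abs_fps (\<lambda>i. if i < b then 1 / real b else 0)"

lemma digit_pmf_gf:
  assumes "b \<ge> 2"
  shows "Abs_fps (pmf (digit_pmf b (Suc k))) =
    (if k = 0 then fps_const (real b / (real b - 1)) * (digit_gf b - fps_const (1 / real b))
     else digit_gf b)"
  using assms
  by (auto simp: fps_eq_iff digit_pmf_def digit_gf_def pmf_of_set indicator_def divide_simps of_nat_diff)

text \<open>
  The generating function of the \<open>k\<close>-th partial sum. The first digit has generating function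
  \<open>(D(x) - 1/b) * b / (b - 1)\<close>: a uniform digit conditioned on not being \<open>0\<close>.
\<close>

definition digit_sum_gf :: "nat \<Rightarrow> nat \<Rightarrow> real fps" where
  "digit_sum_gf b k = (case k of 0 \<Rightarrow> 1
     | Suc i \<Rightarrow> fps_const (real b / (real b - 1)) * (digit_gf b - fps_const
       (1 / real b)) * digit_gf b ^ i)"

lemma prob_digit_sum:
  assumes "b \<ge> 2"
  shows "measure (digits b) {d \<in> space (digits b). digit_sum d k = n} = fps_nth (digit_sum_gf b k) n"
proof (induction k arbitrary: n)
  case 0
  interpret D: prob_space "digits b" by (rule prob_space_digits)
  show ?case by (auto simp: digit_sum_def digit_sum_gf_def D.prob_space)
next
  case (Suc k)
  have "digit_sum d (Suc k) = n \<longleftrightarrow> digit_sum d (Suc k)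
    = n \<and> digit_sum d k < Suc n" for d
    by (auto simp: digit_sum_def)
  then have "measure (digits b) {d \<in> space (digits b). digit_sum d (Suc k) = n} =
    (\<Sum>m<Suc n. fps_nth (digit_sum_gf b k) m * pmf (digit_pmf b (Suc k)) (n - m))"
    using prob_digit_sum_step_below[of "Suc n" n b k] by (simp add: Suc)
  also have "\<dots> = fps_nth (digit_sum_gf b (Suc k)) n"
  proof -
    have "digit_sum_gf b (Suc k) = digit_sum_gf b k * Abs_fps (pmf (digit_pmf b (Suc k)))"
      by (cases k) (simp_all add: digit_sum_gf_def digit_pmf_gf[OF assms] mult_ac)
    then show ?thesis by (simp add: fps_mult_nth atLeast0AtMost lessThan_Suc_atMost)
  qed
  finally show ?case .
qed

text \<open>
  Partial sums are monotone, so a hit is the first one exactly when the partial sum just before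
  it is smaller.
\<close>

lemma first_hit_prob_Suc:
  assumes "b \<ge> 2" "n > 0"
  shows "first_hit_prob b n (Suc k) =
    (\<Sum>m<n. fps_nth (digit_sum_gf b k) m * pmf (digit_pmf b (Suc k)) (n - m))"
proof -
  have mono: "digit_sum d i \<le> digit_sum d j" if "i \<le> j" for d i j
    unfolding digit_sum_def using that by (intro sum_mono2) auto
  have "digit_sum d (Suc k) = n \<and> (\<forall>j<Suc k. digit_sum d j \<noteq> n) \<longleftrightarrow>
      digit_sum d (Suc k) = n \<and> digit_sum d k < n" for d
    using mono[of _ k d] mono[of k "Suc k" d] by (force simp: less_Suc_eq_le)
  then show ?thesis
    using prob_digit_sum_step_below[of n n b k] prob_digit_sum[OF assms(1)] by (simp add: first_hit_prob_def)
qed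

lemma digit_sum_gf_Suc_nth:
  "fps_nth (digit_sum_gf b (Suc i)) n = real b / (real b - 1) *
     (fps_nth (digit_gf b ^ Suc i) n - fps_nth (digit_gf b ^ i) n / real b)"
proof -
  have "digit_sum_gf b (Suc i) = fps_const (real b / (real b - 1)) *
      (digit_gf b ^ Suc i - fps_const (1 / real b) * digit_gf b ^ i)"
    by (simp add: digit_sum_gf_def algebra_simps)
  then show ?thesis by (simp only: fps_mult_left_const_nth fps_sub_nth) simp
qed

text \<open>
  A first hit is a hit whose last digit is not \<open>0\<close>, and removing the term of that digit
  multiplies the generating function by \<open>D - 1/b\<close> instead of \<open>D\<close>. The first digit contributes
  the same factor, so the generating function is \<open>(D - 1/b)^2 * D^(k - 2) * b / (b - 1)\<close> for
  \<open>k \<ge> 2\<close>. For smaller \<open>k\<close> the two sides differ only in the constant coefficient, which \<open>n > 0\<close>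
  excludes.
\<close>

lemma first_hit_prob_digit_gf:
  assumes b: "b \<ge> 2" and n: "n > 0"
  shows "first_hit_prob b n k = (real b ^ 2 * fps_nth (digit_gf b ^ k) n
      - 2 * real b * (if k \<ge> 1 then fps_nth (digit_gf b ^ (k - 1)) n else 0)
      + (if k \<ge> 2 then fps_nth (digit_gf b ^ (k - 2)) n else 0)) / (real b * (real b - 1))"
proof (cases k)
  case 0
  then show ?thesis using n by (simp add: first_hit_prob_def digit_sum_def)
next
  case (Suc i)
  let ?p = "\<lambda>i. pmf (digit_pmf b (Suc i))"
  have "first_hit_prob b n (Suc i) = (\<Sum>m\<le>n. fps_nth (digit_sum_gf b i) m * ?p i (n - m))
      - ?p i 0 * fps_nth (digit_sum_gf b i) n"
    by (subst first_hit_prob_Suc[OF b n]) (simp flip: lessThan_Suc_atMost)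
  also have "(\<Sum>m\<le>n. fps_nth (digit_sum_gf b i) m * ?p i (n - m)) =
      fps_nth (digit_sum_gf b i * Abs_fps (?p i)) n"
    by (simp add: fps_mult_nth atLeast0AtMost)
  also have "digit_sum_gf b i * Abs_fps (?p i) = digit_sum_gf b (Suc i)"
    by (cases i) (simp_all add: digit_sum_gf_def digit_pmf_gf[OF b] mult_ac)
  finally have *: "first_hit_prob b n (Suc i) =
      fps_nth (digit_sum_gf b (Suc i)) n - ?p i 0 * fps_nth (digit_sum_gf b i) n" .
  show ?thesis
  proof (cases i)
    case 0
    have "?p 0 0 = 0" using b by (auto simp: digit_pmf_def pmf_of_set indicator_def)
    then show ?thesis using n b * Suc 0
      by (simp add: digit_sum_gf_Suc_nth divide_simps power2_eq_square)
  next
    case (Suc j)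
    have "?p i 0 = 1 / real b" using b Suc by (auto simp: digit_pmf_def pmf_of_set indicator_def of_nat_diff)
    then have "first_hit_prob b n k = fps_nth (digit_sum_gf b (Suc (Suc j))) n - fps_nth (digit_sum_gf b
      (Suc j)) n / real b"
      using * \<open>k = Suc i\<close> Suc by simp
    then show ?thesis using b \<open>k = Suc i\<close> Suc
      unfolding digit_sum_gf_Suc_nth
        by (simp add: divide_simps del: power_Suc) (simp add: algebra_simps power2_eq_square del: power_Suc)
  qed
qed

section \<open>The resolvent of the digit generating function\<close>

text \<open>
  The quotient \<open>(1 - D(x)) / (1 - x)\<close>, the generating function of the tail probabilities of a
  digit, expanded in powers of \<open>y = 1 - x\<close>.
\<close>

definition tail_poly :: "nat \<Rightarrow> real poly" where
  "tail_poly b = (\<Sum>j<b. monom ((-1) ^ j * real (b choose (j + 2)) / real b) j)"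

lemma coeff_tail_poly: "coeff (tail_poly b) j = (-1) ^ j * real (b choose (j + 2)) / real b"
  by (simp add: tail_poly_def coeff_sum if_distrib cong: if_cong)

text \<open>
  The binomial expansion of \<open>(1 - y)^b\<close>: from order two on, its terms are \<open>b * y^2\<close> times those
  of \<open>tail_poly b\<close>.
\<close>

lemma binomial_expansion_tail_poly:
  assumes "b > 0"
  shows "[:1, -1:] ^ b = 1 - smult (real b) (monom 1 1) + smult (real b) (monom 1 2 * tail_poly b)"
proof (rule poly_eqI)
  fix k
  show "coeff ([:1, -1:] ^ b) k = coeff (1 - smult (real b) (monom 1 1) + smult (real b)
    (monom 1 2 * tail_poly b)) k"
  proof (cases "k < 2")
    case True
    then show ?thesis using assms
      by (auto simp: coeff_linear_poly_power coeff_monom_mult less_2_cases_iff)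
  next
    case False
    then obtain j where "k = j + 2" by (metis add.commute le_Suc_ex not_less)
    then show ?thesis using assms
      by (cases "k \<le> b")
        (simp_all add: coeff_linear_poly_power coeff_monom_mult coeff_tail_poly coeff_eq_0 degree_power_eq)
  qed
qed

text \<open>
  The previous expansion with \<open>y = 1 - x\<close> substituted, so that its left-hand side becomes \<open>x^b\<close>.
\<close>

lemma power_eq_tail_poly:
  assumes "b > 0"
  shows "monom 1 b = 1 - smult (real b) [:1, -1:]
    + smult (real b) ([:1, -1:] ^ 2 * pcompose (tail_poly b) [:1, -1:])"
proof -
  have "pcompose ([:1, -1:] ^ b) [:1, -1:] = pcompose (1 - smult (real b) (monom 1 1) + smult (real b)
    (monom 1 2 * tail_poly b)) [:1, -1:]"
    by (simp only: binomial_expansion_tail_poly[OF assms])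
  then show ?thesis
    by (simp add: pcompose_add pcompose_diff pcompose_smult pcompose_mult pcompose_1 pcompose_power
      monom_altdef pcompose_pCons)
qed

text \<open>
  By the geometric sum, \<open>b * (1 - x) * D(x) = 1 - x^b\<close>; now insert the expansion of \<open>x^b\<close> and
  cancel.
\<close>

lemma one_minus_digit_gf:
  assumes "b > 0"
  shows "1 - digit_gf b = (1 - fps_X) * at_one (tail_poly b)"
proof -
  have "(1 - fps_X) * (fps_const (real b) * digit_gf b) = 1 - fps_X ^ b"
    using assms
    by (auto simp: fps_eq_iff digit_gf_def left_diff_distrib fps_X_power_nth)
  also have "fps_X ^ b = fps_of_poly (monom (1::real) b)"
    by (simp add: fps_of_poly_monom)
  also have "\<dots> = 1 - fps_const (real b) * (1 - fps_X)
    + fps_const (real b) * ((1 - fps_X)^2 * at_one (tail_poly b))"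
    unfolding power_eq_tail_poly[OF assms]
    by (simp add: fps_of_poly_add fps_of_poly_diff fps_of_poly_smult fps_of_poly_mult fps_of_poly_power fps_of_poly_one_minus_X
        del: fps_of_poly_pCons)
  finally have "(fps_const (real b) * (1 - fps_X)) * (1 - digit_gf b) =
      (fps_const (real b) * (1 - fps_X)) * ((1 - fps_X) * at_one (tail_poly b))"
    by (simp add: algebra_simps power2_eq_square)
  moreover have "fps_const (real b) * (1 - fps_X) \<noteq> 0"
    using assms by (auto simp: fps_eq_iff intro!: exI[of _ 0])
  ultimately show ?thesis by simp
qed

lemma map_poly_of_real_mult: "map_poly complex_of_real (p * q) = map_poly of_real p * map_poly of_real q"
  by (simp add: poly_eq_iff coeff_map_poly coeff_mult)

text \<open>
  A zero \<open>z \<noteq> 1\<close> would satisfy \<open>D(z) = 1\<close>: the powers \<open>z^0, ..., z^(b-1)\<close>, all of modulus at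
  most one, would have average \<open>1\<close>. So all their real parts are \<open>1\<close>, and since \<open>z\<close> is among them
  because of \<open>b \<ge> 2\<close>, this forces \<open>z = 1\<close>. The value at \<open>1\<close> itself is the expectation
  \<open>(b - 1) / 2\<close> of a digit.
\<close>

lemma tail_poly_nonzero:
  assumes b: "b \<ge> 2" and z: "norm (z::complex) \<le> 1"
  shows "poly (map_poly of_real (pcompose (tail_poly b) [:1, -1:])) z \<noteq> 0"
proof
  let ?T = "pcompose (tail_poly b) [:1, -1:]"
  assume 0: "poly (map_poly of_real ?T) z = 0"
  have "map_poly complex_of_real (monom 1 b) = map_poly of_real (1 - smult (real b) [:1, -1:]
    + smult (real b) ([:1, -1:] ^ 2 * ?T))"
    using b by (simp only: power_eq_tail_poly)
  also have "\<dots> = 1 - smult (of_nat b) [:1, -1:] + smult (of_nat b) (map_poly of_real ([:1,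
    -1:] ^ 2 * ?T))"
    by (simp add: poly_eq_iff coeff_map_poly coeff_1 coeff_pCons split: nat.split)
  finally have "monom 1 b = 1 - smult (complex_of_nat b) [:1, -1:] +
      smult (of_nat b) (map_poly of_real ([:1, -1:] ^ 2) * map_poly of_real ?T)"
    unfolding map_poly_of_real_mult by (simp add: map_poly_monom)
  from arg_cong[OF this, of "\<lambda>p. poly p z"] have *: "z ^ b = 1 - of_nat b * (1 - z)"
    using 0 by (simp add: poly_monom algebra_simps)
  show False
  proof (cases "z = 1")
    case True
    have "poly (map_poly complex_of_real ?T) (of_real 1) = of_real (poly ?T 1)"
      by (simp add: poly_altdef coeff_map_poly degree_map_poly)
    moreover have "poly ?T 1 = coeff (tail_poly b) 0"
      by (simp add: poly_pcompose poly_0_coeff_0)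
    moreover have "\<dots> \<noteq> 0" using b by (simp add: coeff_tail_poly)
    ultimately show False using 0 True by simp
  next
    case False
    have "(1 - z) * (\<Sum>i<b. z ^ i) = (1 - z) * of_nat b"
      using * by (simp add: sum_gp_strict[of z b] False)
    then have "(\<Sum>i<b. z ^ i) = of_nat b" using False by simp
    then have "(\<Sum>i<b. Re (z ^ i)) = (\<Sum>i<b. 1)"
      by (metis Re_sum complex_Re_of_nat sum_constant card_lessThan mult.right_neutral)
    moreover have le: "Re (z ^ i) \<le> 1" for i
      using complex_Re_le_cmod[of "z ^ i"] z by (simp add: norm_power power_le_one order_trans)
    ultimately have "Re (z ^ 1) = 1"
      using b sum_mono_inv[of "\<lambda>i. Re (z ^ i)" "{..<b}" "\<lambda>_. 1" 1] by auto
    then have "Re z = 1" by simp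
    moreover from this have "Im z = 0" using z by (simp add: cmod_def)
    ultimately show False using False by (simp add: complex_eq_iff)
  qed
qed

text \<open>
  At \<open>1\<close> the \<open>m\<close>-th power of \<open>1 / (1 - D)\<close> has a pole of order \<open>m\<close>, and it has no other
  singularity in the closed unit disc. The principal part is read off from the Taylor series of
  the \<open>m\<close>-th power of \<open>(1 - x) / (1 - D(x))\<close>.
\<close>

lemma digit_resolvent_expansion:
  assumes "b \<ge> 2"
  shows "exp_small (\<lambda>n. fps_nth (inverse (1 - digit_gf b) ^ m) n
     - (\<Sum>j<m. fps_nth (inverse (fps_of_poly (tail_poly b)) ^ m) j * real ((n + (m - 1 - j)) choose
       (m - 1 - j))))"
proof -
  have "expands_at_one (inverse (at_one (tail_poly b))) (inverse (fps_of_poly (tail_poly b)))"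
  proof (rule expands_at_one_inverse_of_poly)
    show "coeff (tail_poly b) 0 \<noteq> 0" using assms by (simp add: coeff_tail_poly)
    show "decaying (inverse (at_one (tail_poly b)))"
      using tail_poly_nonzero[OF assms] by (rule decaying_inverse_of_poly)
    have "fps_nth (1 - digit_gf b) 0 \<noteq> 0" using assms by (simp add: digit_gf_def)
    then show "fps_nth (at_one (tail_poly b)) 0 \<noteq> 0"
      using assms by (simp add: one_minus_digit_gf)
  qed
  from pole_coefficients[OF expands_at_one_power[OF this, of m], of m]
  show ?thesis using assms
    by (simp add: one_minus_digit_gf fps_inverse_mult power_mult_distrib fps_inverse_power)
qed

section \<open>Summation over the number of digits\<close>

lemma digit_gf_power_nonneg: "0 \<le> fps_nth (digit_gf b ^ k) n"
  by (induction k arbitrary: n) (auto simp: fps_one_nth fps_mult_nth digit_gf_def intro!: sum_nonneg)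

text \<open>
  All coefficients of \<open>D^k\<close> are nonnegative, so a single term is at most the value \<open>D(x)^k\<close>.
\<close>

lemma digit_gf_power_le:
  assumes x: "0 < x" "x \<le> 1"
  shows "fps_nth (digit_gf b ^ k) n * x ^ n \<le> ((\<Sum>i<b. x ^ i) / real b) ^ k"
proof (induction k arbitrary: n)
  case 0
  then show ?case by (simp add: fps_one_nth)
next
  case (Suc k)
  let ?r = "(\<Sum>i<b. x ^ i) / real b"
  have r: "0 \<le> ?r" using x by (simp add: sum_nonneg)
  have "fps_nth (digit_gf b ^ Suc k) n * x ^ n =
      (\<Sum>i\<le>n. (fps_nth (digit_gf b) i * x ^ i) * (fps_nth (digit_gf b ^ k) (n - i) * x ^ (n - i)))"
    unfolding power_Suc fps_mult_nth sum_distrib_right atLeast0AtMost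
  proof (intro sum.cong refl)
    fix i assume "i \<in> {..n}"
    then have "x ^ n = x ^ i * x ^ (n - i)" by (simp flip: power_add)
    then show "fps_nth (digit_gf b) i * fps_nth (digit_gf b ^ k) (n - i) * x ^ n =
        (fps_nth (digit_gf b) i * x ^ i) * (fps_nth (digit_gf b ^ k) (n - i) * x ^ (n - i))"
      by simp
  qed
  also have "\<dots> \<le> (\<Sum>i\<le>n. (fps_nth (digit_gf b) i * x ^ i) * ?r ^ k)"
    using Suc x by (intro sum_mono mult_left_mono) (auto simp: digit_gf_def)
  also have "\<dots> = (\<Sum>i\<le>n. fps_nth (digit_gf b) i * x ^ i) * ?r ^ k"
    by (simp add: sum_distrib_right)
  also have "(\<Sum>i\<le>n. fps_nth (digit_gf b) i * x ^ i) =
    (\<Sum>i\<in>{..n} \<inter> {..<b}. x ^ i / real b)"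
    by (simp add: digit_gf_def sum.If_cases if_distrib[of "\<lambda>c. c * _"] Int_def lessThan_def cong: if_cong)
  also have "\<dots> \<le> (\<Sum>i<b. x ^ i / real b)"
    using x by (intro sum_mono2) auto
  also have "\<dots> = ?r" by (simp add: sum_divide_distrib)
  finally show ?case using r by (simp add: mult_right_mono)
qed

text \<open>
  Here \<open>n\<close> is fixed and the number of digits grows. The bound above at \<open>x = 1/2\<close> gives the rate
  \<open>D(1/2) < 1\<close>; this makes all moments finite.
\<close>

lemma exp_small_digit_gf_power:
  assumes "b \<ge> 2"
  shows "exp_small (\<lambda>k. fps_nth (digit_gf b ^ k) n)"
proof -
  define r where "r = (\<Sum>i<b. (1/2) ^ i) / real b"
  have "(\<Sum>i<b. (1/2::real) ^ i) < (\<Sum>i<b. 1)"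
    using assms by (intro sum_strict_mono_ex1) (auto simp: power_le_one intro!: bexI[of _ 1])
  moreover have "(\<Sum>i<b. (1/2::real) ^ i) > 0"
    using assms by (intro sum_pos) (auto simp: lessThan_empty_iff)
  ultimately have r: "0 < r" "r < 1" using assms by (auto simp: r_def)
  have "norm (fps_nth (digit_gf b ^ k) n) \<le> 2 ^ n * norm (r ^ k)" for k
  proof -
    have "norm (r ^ k) = r ^ k" using r by simp
    moreover have "fps_nth (digit_gf b ^ k) n * (1 / 2) ^ n \<le> r ^ k"
      unfolding r_def by (rule digit_gf_power_le) auto
    ultimately show ?thesis
      using digit_gf_power_nonneg[of b k n] by (simp add: power_divide field_simps)
  qed
  then have "(\<lambda>k. fps_nth (digit_gf b ^ k) n) \<in> O(\<lambda>k. r ^ k)"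
    by (intro bigoI always_eventually allI)
  then show ?thesis unfolding exp_small_def using r by blast
qed

lemma summable_poly_digit_gf_power:
  assumes "b \<ge> 2"
  shows "summable (\<lambda>k. poly p (real k) * fps_nth (digit_gf b ^ k) n)"
  by (intro summable_norm_cancel[OF exp_small_summable] exp_small_poly_mult exp_small_digit_gf_power assms)

text \<open>
  The polynomial \<open>(x + 1) ... (x + m) / m!\<close>, whose value at \<open>k\<close> is \<open>binomial(k + m, m)\<close>.
\<close>

definition rising_poly :: "nat \<Rightarrow> real poly" where
  "rising_poly m = smult (1 / fact m) (\<Prod>i<m. [:real (i + 1), 1:])"

lemma poly_rising_poly: "poly (rising_poly m) (real k) = real ((k + m) choose m)"
proof (induction m)
  case 0
  then show ?case by (simp add: rising_poly_def)
next
  case (Suc m)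
  have "poly (rising_poly (Suc m)) (real k) = poly (rising_poly m) (real k) * (real (k + Suc m) / real (Suc m))"
    by (simp add: rising_poly_def poly_prod divide_simps) (simp add: algebra_simps)
  also have "\<dots> = real (((k + m) choose m) * (k + Suc m)) / real (Suc m)"
    unfolding Suc by (simp add: distrib_left)
  also have "((k + m) choose m) * (k + Suc m) = ((k + Suc m) choose Suc m) * Suc m"
    using Suc_times_binomial_eq[of "k + m" m] by (simp add: mult.commute)
  finally show ?case
    by (simp del: of_nat_Suc mult_Suc_right binomial_Suc_Suc add_Suc_right)
qed

text \<open>
  Formally this is the expansion of \<open>(1 - z * D)^(-(m + 1))\<close> in \<open>z\<close>, evaluated at \<open>z = 1\<close>. Since
  \<open>D\<close> has a nonzero constant term, the sum over \<open>k\<close> does not converge in the ring of formal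
  power series, but only as a series of real numbers for each coefficient. So the left-hand side
  \<open>G m\<close> is shown to satisfy \<open>(1 - D) * G 0 = 1\<close> and \<open>(1 - D) * G (m + 1) = G m\<close>, the latter
  because the difference of consecutive values of one binomial is the binomial of lower order.
\<close>

lemma rising_poly_digit_series:
  assumes b: "b \<ge> 2"
  shows "(\<Sum>k. poly (rising_poly m) (real k) * fps_nth (digit_gf b ^ k) n) =
    fps_nth (inverse (1 - digit_gf b) ^ Suc m) n"
proof -
  define G where "G m = Abs_fps (\<lambda>n. \<Sum>k. poly (rising_poly m) (real k) * fps_nth
    (digit_gf b ^ k) n)" for m
  note summ = summable_poly_digit_gf_power[OF b]
  have unit: "fps_nth (1 - digit_gf b) 0 \<noteq> 0" using b by (simp add: digit_gf_def)
  have "fps_nth (digit_gf b * G m) n = (\<Sum>k. poly (rising_poly m) (real k) * fps_nth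
    (digit_gf b ^ Suc k) n)" for m n
  proof -
    have "fps_nth (digit_gf b * G m) n =
        (\<Sum>i\<le>n. \<Sum>k. fps_nth (digit_gf b) i * (poly (rising_poly m) (real k) * fps_nth
        (digit_gf b ^ k) (n - i)))"
      by (simp add: fps_mult_nth atLeast0AtMost G_def suminf_mult[OF summ])
    also have "\<dots> = (\<Sum>k. \<Sum>i\<le>n. fps_nth (digit_gf b) i * (poly (rising_poly m)
      (real k) * fps_nth (digit_gf b ^ k) (n - i)))"
      by (intro suminf_sum[symmetric] summable_mult summ)
    finally show ?thesis
      by (simp add: fps_mult_nth atLeast0AtMost sum_distrib_left mult_ac)
  qed
  moreover have "fps_nth (G m) n = poly (rising_poly m) 0 * fps_nth 1 n +
      (\<Sum>k. poly (rising_poly m) (real (Suc k)) * fps_nth (digit_gf b ^ Suc k) n)" for m n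
    using suminf_split_head[OF summ[of "rising_poly m" n]] by (simp add: G_def)
  moreover have "summable (\<lambda>k. poly (rising_poly m) (real k) * fps_nth (digit_gf b ^ Suc k) n)" for m n
    using summable_ignore_initial_segment[OF summ[of "pcompose (rising_poly m) [:-1, 1:]" n], of 1]
    by (simp add: poly_pcompose)
  moreover have "summable (\<lambda>k. poly (rising_poly m) (real (Suc k)) * fps_nth
    (digit_gf b ^ Suc k) n)" for m n
    using summable_ignore_initial_segment[OF summ[of "rising_poly m" n], of 1] by simp
  ultimately have step: "fps_nth ((1 - digit_gf b) * G m) n = poly (rising_poly m) 0 * fps_nth 1 n +
      (\<Sum>k. (poly (rising_poly m) (real (Suc k)) - poly (rising_poly m) (real k)) * fps_nth
        (digit_gf b ^ Suc k) n)" for m n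
    by (simp add: left_diff_distrib suminf_diff)
  have rise0: "poly (rising_poly m) 0 = 1" for m
    using poly_rising_poly[of m 0] by simp
  have "G m = inverse (1 - digit_gf b) ^ Suc m"
  proof (induction m)
    case 0
    have "(1 - digit_gf b) * G 0 = 1"
      by (rule fps_ext) (simp add: step rise0, simp add: rising_poly_def)
    then show ?case using fps_inverse_unique by fastforce
  next
    case (Suc m)
    have "(1 - digit_gf b) * G (Suc m) = G m"
    proof (rule fps_ext)
      fix n
      have "poly (rising_poly (Suc m)) (real (Suc k)) - poly (rising_poly (Suc m)) (real k)
          = poly (rising_poly m) (real (Suc k))" for k
        unfolding poly_rising_poly by simp
      then have "fps_nth ((1 - digit_gf b) * G (Suc m)) n = fps_nth 1 n +
        (\<Sum>k. poly (rising_poly m) (real (Suc k)) * fps_nth (digit_gf b ^ Suc k) n)"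
        unfolding step rise0 by simp
      also have "\<dots> = fps_nth (G m) n"
        using suminf_split_head[OF summ[of "rising_poly m" n]] by (simp add: G_def rise0)
      finally show "fps_nth ((1 - digit_gf b) * G (Suc m)) n = fps_nth (G m) n" .
    qed
    then have "inverse (1 - digit_gf b) * ((1 - digit_gf b) * G (Suc m)) = inverse (1 - digit_gf b) ^ Suc
      (Suc m)"
      by (simp only: Suc power_Suc)
    moreover have "inverse (1 - digit_gf b) * ((1 - digit_gf b) * G (Suc m)) = G (Suc m)"
      unfolding mult.assoc[symmetric] by (simp only: inverse_mult_eq_1[OF unit] mult_1_left)
    ultimately show ?case by simp
  qed
  then show ?thesis by (simp add: G_def fps_eq_iff)
qed

text \<open>
  By shifting the index of summation, the shifts of \<open>k\<close> in the formula for the first-hit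
  probabilities are moved to the polynomial.
\<close>

lemma first_hit_poly_sums:
  assumes b: "b \<ge> 2" and n: "n > 0"
  shows "(\<lambda>k. poly p (real k) * first_hit_prob b n k) sums
    ((\<Sum>k. (real b ^ 2 * poly p (real k) - 2 * real b * poly p (real k + 1) + poly p (real k + 2))
       * fps_nth (digit_gf b ^ k) n) / (real b * (real b - 1)))"
proof -
  let ?c = "\<lambda>k. fps_nth (digit_gf b ^ k) n"
  define s0 where "s0 = (\<Sum>k. poly p (real k) * ?c k)"
  define s1 where "s1 = (\<Sum>k. poly p (real k + 1) * ?c k)"
  define s2 where "s2 = (\<Sum>k. poly p (real k + 2) * ?c k)"
  note summ = summable_poly_digit_gf_power[OF b, of _ n]
  have s0: "(\<lambda>k. poly p (real k) * ?c k) sums s0"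
    unfolding s0_def by (intro summable_sums summ)
  have s1: "(\<lambda>k. poly p (real k + 1) * ?c k) sums s1"
    unfolding s1_def using summ[of "pcompose p [:1, 1:]"]
    by (intro summable_sums) (simp add: poly_pcompose add.commute)
  have s2: "(\<lambda>k. poly p (real k + 2) * ?c k) sums s2"
    unfolding s2_def using summ[of "pcompose p [:2, 1:]"]
    by (intro summable_sums) (simp add: poly_pcompose add.commute)
  have s1': "(\<lambda>k. poly p (real k) * (if k \<ge> 1 then ?c (k - 1) else 0)) sums s1"
    by (rule sums_Suc_imp) (use s1 in \<open>simp_all add: add.commute\<close>)
  have s2': "(\<lambda>k. poly p (real k) * (if k \<ge> 2 then ?c (k - 2) else 0)) sums s2"
    by (rule sums_Suc_imp[OF _ sums_Suc_imp]) (use s2 in \<open>simp_all add: add.commute\<close>)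
  have "(\<lambda>k. (real b ^ 2 * (poly p (real k) * ?c k)
      - 2 * real b * (poly p (real k) * (if k \<ge> 1 then ?c (k - 1) else 0))
      + poly p (real k) * (if k \<ge> 2 then ?c (k - 2) else 0)) / (real b * (real b - 1))) sums
      ((real b ^ 2 * s0 - 2 * real b * s1 + s2) / (real b * (real b - 1)))"
    by (intro sums_divide sums_add sums_diff sums_mult s0 s1' s2')
  moreover have "(\<lambda>k. (real b ^ 2 * poly p (real k) - 2 * real b * poly p (real k + 1) + poly p
    (real k + 2)) * ?c k)
      sums (real b ^ 2 * s0 - 2 * real b * s1 + s2)"
    using sums_add[OF sums_diff[OF sums_mult[OF s0, of "real b ^ 2"] sums_mult[OF s1, of "2 * real b"]] s2]
    by (simp add: algebra_simps)
  ultimately show ?thesis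
    by (simp only: first_hit_prob_digit_gf[OF b n] sums_unique[symmetric]) (simp add: algebra_simps)
qed

lemma poly_rising_poly_0: "poly (rising_poly 0) x = 1"
  by (simp add: rising_poly_def)

lemma poly_rising_poly_Suc:
  "poly (rising_poly (Suc m)) x = poly (rising_poly m) x * (x + real m + 1) / (real m + 1)"
  by (simp add: rising_poly_def poly_prod field_simps)

text \<open>
  The left-hand side of \<open>e\<close> is the polynomial that the index shifts produce from \<open>p\<close>. Its
  coordinates \<open>e m\<close> in the basis \<open>rising_poly\<close> are the coefficients of the powers of the
  resolvent.
\<close>

lemma first_hit_moment_asymptotics:
  assumes b: "b \<ge> 2"
    and e: "\<And>x. real b ^ 2 * poly p x - 2 * real b * poly p (x + 1) + poly p (x + 2) =
      (\<Sum>m<r. e m * poly (rising_poly m) x)"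
  shows "exp_small (\<lambda>n. (\<Sum>k. poly p (real k) * first_hit_prob b n k) -
     (\<Sum>m<r. e m * (\<Sum>j<Suc m. fps_nth (inverse (fps_of_poly (tail_poly b)) ^ Suc m) j *
        poly (rising_poly (m - j)) (real n))) / (real b * (real b - 1)))"
proof -
  let ?U = "\<lambda>m n. fps_nth (inverse (1 - digit_gf b) ^ Suc m) n"
  let ?a = "\<lambda>m n. \<Sum>j<Suc m. fps_nth (inverse (fps_of_poly (tail_poly b)) ^ Suc m) j *
        poly (rising_poly (m - j)) (real n)"
  have "(\<Sum>k. poly p (real k) * first_hit_prob b n k) = (\<Sum>m<r. e m * ?U m n) / (real b * (real b - 1))"
    if n: "n > 0" for n
  proof -
    have "(\<Sum>k. poly p (real k) * first_hit_prob b n k) =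
        (\<Sum>k. \<Sum>m<r. e m * (poly (rising_poly m) (real k) * fps_nth (digit_gf b ^ k) n)) /
        (real b * (real b - 1))"
      by (subst sums_unique[OF first_hit_poly_sums[OF b n], symmetric])
        (simp only: e, simp only: sum_distrib_right mult.assoc)
    also have "(\<Sum>k. \<Sum>m<r. e m * (poly (rising_poly m) (real k) * fps_nth (digit_gf b ^ k) n)) =
        (\<Sum>m<r. e m * ?U m n)"
      by (subst suminf_sum)
        (simp_all add: summable_mult summable_poly_digit_gf_power[OF b] suminf_mult rising_poly_digit_series[OF b])
    finally show ?thesis .
  qed
  then have ev: "eventually (\<lambda>n. (\<Sum>k. poly p (real k) * first_hit_prob b n k) -
    (\<Sum>m<r. e m * ?a m n) / (real b * (real b - 1))
      = 1 / (real b * (real b - 1)) * (\<Sum>m<r. e m * (?U m n - ?a m n))) sequentially"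
    by (intro eventually_mono[OF eventually_gt_at_top[of 0]])
      (simp add: sum_subtractf right_diff_distrib diff_divide_distrib)
  have "exp_small (\<lambda>n. ?U m n - ?a m n)" for m
    using digit_resolvent_expansion[OF b, of "Suc m"] by (simp add: poly_rising_poly del: power_Suc)
  then show ?thesis
    unfolding exp_small_cong[OF ev] by (intro exp_small_cmult exp_small_sum)
qed

section \<open>Taylor coefficients of the powers of the resolvent\<close>

lemma fps_mult_nth_upto_5:
  fixes F G :: "'a :: comm_ring_1 fps"
  shows
    "fps_nth (F * G) 0 = fps_nth F 0 * fps_nth G 0"
    "fps_nth (F * G) 1 = fps_nth F 0 * fps_nth G 1 + fps_nth F 1 * fps_nth G 0"
    "fps_nth (F * G) 2 = fps_nth F 0 * fps_nth G 2 + fps_nth F 1 * fps_nth G 1 + fps_nth F 2 * fps_nth G 0"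
    "fps_nth (F * G) 3 = fps_nth F 0 * fps_nth G 3 + fps_nth F 1 * fps_nth G 2
      + fps_nth F 2 * fps_nth G 1 + fps_nth F 3 * fps_nth G 0"
    "fps_nth (F * G) 4 = fps_nth F 0 * fps_nth G 4 + fps_nth F 1 * fps_nth G 3
      + fps_nth F 2 * fps_nth G 2 + fps_nth F 3 * fps_nth G 1 + fps_nth F 4 * fps_nth G 0"
    "fps_nth (F * G) 5 = fps_nth F 0 * fps_nth G 5 + fps_nth F 1 * fps_nth G 4
      + fps_nth F 2 * fps_nth G 3 + fps_nth F 3 * fps_nth G 2 + fps_nth F 4 * fps_nth G 1
        + fps_nth F 5 * fps_nth G 0"
  by (simp_all add: fps_mult_nth numeral_eq_Suc)

text \<open>
  Scaled to constant term \<open>1\<close>, the coefficients are polynomials in \<open>b\<close> without denominators in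
  \<open>b\<close>.
\<close>

definition norm_tail :: "nat \<Rightarrow> real fps" where
  "norm_tail b = fps_const (2 / (real b - 1)) * fps_of_poly (tail_poly b)"

lemma norm_tail_nth:
  assumes "b \<ge> 2"
  shows
    "fps_nth (norm_tail b) 0 = 1"
    "fps_nth (norm_tail b) 1 = - ((real b - 2) / 3)"
    "fps_nth (norm_tail b) 2 = (real b^2 - 5 * real b + 6) / 12"
    "fps_nth (norm_tail b) 3 = - ((real b^3 - 9 * real b^2 + 26 * real b - 24) / 60)"
    "fps_nth (norm_tail b) 4 = (real b^4 - 14 * real b^3 + 71 * real b^2 - 154 * real b + 120) / 360"
    "fps_nth (norm_tail b) 5 = - ((real b^5 - 20 * real b^4 + 155 * real b^3 - 580 * real b^2
      + 1044 * real b - 720) / 2520)"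
  using assms
  by (simp_all add: norm_tail_def coeff_tail_poly binomial_gbinomial gbinomial_prod_rev
        numeral_eq_Suc divide_simps) (simp_all add: algebra_simps)

text \<open>
  The coefficients are determined one after the other from those of the product with the
  original series, which is \<open>1\<close>.
\<close>

lemma inverse_norm_tail_nth:
  assumes b: "b \<ge> 2" and H_def: "H = inverse (norm_tail b)"
  shows
    "fps_nth H 0 = 1"
    "fps_nth H 1 = (real b - 2) / 3"
    "fps_nth H 2 = (real b^2 - real b - 2) / 36"
    "fps_nth H 3 = - ((real b^3 - 9 * real b^2 + 6 * real b + 16) / 540)"
    "fps_nth H 4 = - ((real b^4 + 10 * real b^3 - 75 * real b^2 + 40 * real b + 124) / 6480)"
    "fps_nth H 5 = (5 * real b^5 - 44 * real b^4 - 163 * real b^3 + 1202 * real b^2 - 548 * real b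
      - 1864) / 136080"
proof -
  note h = norm_tail_nth[OF b]
  have "norm_tail b * H = 1"
    unfolding H_def using h(1) by (intro inverse_mult_eq_1') simp
  then have hH: "fps_nth (norm_tail b * H) j = fps_nth 1 j" for j by simp
  show H0: "fps_nth H 0 = 1" using hH[of 0] by (simp add: h)
  show H1: "fps_nth H 1 = (real b - 2) / 3"
    using hH[of 1] unfolding fps_mult_nth_upto_5 h H0 by (simp add: field_simps power_numeral_reduce)
  show H2: "fps_nth H 2 = (real b^2 - real b - 2) / 36"
    using hH[of 2] unfolding fps_mult_nth_upto_5 h H0 H1 by (simp add: field_simps power_numeral_reduce)
  show H3: "fps_nth H 3 = - ((real b^3 - 9 * real b^2 + 6 * real b + 16) / 540)"
    using hH[of 3] unfolding fps_mult_nth_upto_5 h H0 H1 H2 by (simp add: field_simps power_numeral_reduce)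
  show H4: "fps_nth H 4 = - ((real b^4 + 10 * real b^3 - 75 * real b^2 + 40 * real b + 124) / 6480)"
    using hH[of 4] unfolding fps_mult_nth_upto_5 h H0 H1 H2 H3 by (simp add: field_simps power_numeral_reduce)
  show H5: "fps_nth H 5 = (5 * real b^5 - 44 * real b^4 - 163 * real b^3 + 1202 * real b^2 - 548 * real b
    - 1864) / 136080"
    using hH[of 5] unfolding fps_mult_nth_upto_5 h H0 H1 H2 H3 H4
      by (simp add: field_simps power_numeral_reduce)
qed

text \<open>
  The splittings along which the coefficients of the powers are computed. Up to the third power
  all coefficients of order at most five are needed, since they enter the sixth power; for the
  fourth and fifth power those of the principal part suffice.
\<close>

lemma power_splits:
  fixes H :: "real fps"
  shows "H ^ 2 = H * H" "H ^ 3 = H * H ^ 2" "H ^ 4 = H * H ^ 3" "H ^ 5 = H ^ 2 * H ^ 3"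
    "H ^ 6 = H ^ 3 * H ^ 3"
  by (simp_all add: power_numeral_reduce mult_ac)

lemma inverse_norm_tail_square_nth:
  assumes b: "b \<ge> 2" and H_def: "H = inverse (norm_tail b)"
  shows
    "fps_nth (H ^ 2) 0 = 1"
    "fps_nth (H ^ 2) 1 = (2 * real b - 4) / 3"
    "fps_nth (H ^ 2) 2 = (real b^2 - 3 * real b + 2) / 6"
    "fps_nth (H ^ 2) 3 = (2 * real b^3 - 3 * real b^2 - 3 * real b + 2) / 135"
    "fps_nth (H ^ 2) 4 = - ((5 * real b^4 - 58 * real b^3 + 57 * real b^2 + 92 * real b - 28) / 6480)"
    "fps_nth (H ^ 2) 5 = - ((3 * real b^5 + 10 * real b^4 - 137 * real b^3 + 108 * real b^2
      + 220 * real b - 32) / 22680)"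
  unfolding power_splits(1) fps_mult_nth_upto_5 inverse_norm_tail_nth[OF assms]
  by (simp_all add: field_simps power_numeral_reduce)

lemma inverse_norm_tail_cube_nth:
  assumes b: "b \<ge> 2" and H_def: "H = inverse (norm_tail b)"
  shows
    "fps_nth (H ^ 3) 0 = 1"
    "fps_nth (H ^ 3) 1 = real b - 2"
    "fps_nth (H ^ 3) 2 = (5 * real b^2 - 17 * real b + 14) / 12"
    "fps_nth (H ^ 3) 3 = (47 * real b^3 - 183 * real b^2 + 222 * real b - 88) / 540"
    "fps_nth (H ^ 3) 4 = (4 * real b^4 - 8 * real b^3 - 3 * real b^2 + 7 * real b - 2) / 540"
    "fps_nth (H ^ 3) 5 = - ((4 * real b^5 - 52 * real b^4 + 67 * real b^3 + 67 * real b^2 - 52 * real b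
      + 4) / 11340)"
  unfolding power_splits(2) fps_mult_nth_upto_5 inverse_norm_tail_nth[OF assms] inverse_norm_tail_square_nth[OF assms]
  by (simp_all add: field_simps power_numeral_reduce)

lemma inverse_norm_tail_power4_nth:
  assumes b: "b \<ge> 2" and H_def: "H = inverse (norm_tail b)"
  shows
    "fps_nth (H ^ 4) 0 = 1"
    "fps_nth (H ^ 4) 1 = (4 * real b - 8) / 3"
    "fps_nth (H ^ 4) 2 = (7 * real b^2 - 25 * real b + 22) / 9"
    "fps_nth (H ^ 4) 3 = (34 * real b^3 - 156 * real b^2 + 234 * real b - 116) / 135"
  unfolding power_splits(3) fps_mult_nth_upto_5 inverse_norm_tail_nth[OF assms] inverse_norm_tail_cube_nth[OF assms]
  by (simp_all add: field_simps power_numeral_reduce)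

lemma inverse_norm_tail_power5_nth:
  assumes b: "b \<ge> 2" and H_def: "H = inverse (norm_tail b)"
  shows
    "fps_nth (H ^ 5) 0 = 1"
    "fps_nth (H ^ 5) 1 = (5 * real b - 10) / 3"
    "fps_nth (H ^ 5) 2 = (15 * real b^2 - 55 * real b + 50) / 12"
    "fps_nth (H ^ 5) 3 = (59 * real b^3 - 291 * real b^2 + 474 * real b - 256) / 108"
    "fps_nth (H ^ 5) 4 = (193 * real b^4 - 1094 * real b^3 + 2301 * real b^2 - 2144 * real b + 748) / 1296"
  unfolding power_splits(4) fps_mult_nth_upto_5 inverse_norm_tail_square_nth[OF assms] inverse_norm_tail_cube_nth[OF assms]
  by (simp_all add: field_simps power_numeral_reduce)

lemma inverse_norm_tail_power6_nth:
  assumes b: "b \<ge> 2" and H_def: "H = inverse (norm_tail b)"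
  shows
    "fps_nth (H ^ 6) 0 = 1"
    "fps_nth (H ^ 6) 1 = 2 * real b - 4"
    "fps_nth (H ^ 6) 2 = (11 * real b^2 - 41 * real b + 38) / 6"
    "fps_nth (H ^ 6) 3 = (136 * real b^3 - 699 * real b^2 + 1191 * real b - 674) / 135"
    "fps_nth (H ^ 6) 4 = (261 * real b^4 - 1610 * real b^3 + 3705 * real b^2 - 3780 * real b + 1444) / 720"
    "fps_nth (H ^ 6) 5 = (655 * real b^5 - 4378 * real b^4 + 11659 * real b^3 - 15536 * real b^2
      + 10364 * real b - 2768) / 7560"
  unfolding power_splits(5) fps_mult_nth_upto_5 inverse_norm_tail_cube_nth[OF assms]
  by (simp_all add: field_simps power_numeral_reduce)

lemmas inverse_norm_tail_power_nths = inverse_norm_tail_nth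
  inverse_norm_tail_square_nth
  inverse_norm_tail_cube_nth
  inverse_norm_tail_power4_nth
  inverse_norm_tail_power5_nth
  inverse_norm_tail_power6_nth

lemma inverse_tail_poly:
  assumes "b \<ge> 2"
  shows "inverse (fps_of_poly (tail_poly b)) = fps_const (2 / (real b - 1)) * inverse (norm_tail b)"
proof -
  have "fps_nth (norm_tail b) 0 \<noteq> 0" using norm_tail_nth(1)[OF assms] by simp
  then have "norm_tail b * inverse (norm_tail b) = 1" by (rule inverse_mult_eq_1')
  then have "fps_of_poly (tail_poly b) * (fps_const (2 / (real b - 1)) * inverse (norm_tail b)) = 1"
    unfolding norm_tail_def[of b] by (simp add: mult_ac)
  then show ?thesis by (rule fps_inverse_unique)
qed

section \<open>Raw moments\<close>

text \<open>
  The sum of \<open>k^r\<close> over the first-hit probabilities, not yet conditioned on being \<open>n\<close>-evil. The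
  moment of order \<open>0\<close> is the probability of being \<open>n\<close>-evil.
\<close>

definition hit_moment :: "nat \<Rightarrow> nat \<Rightarrow> nat \<Rightarrow> real" where
  "hit_moment b r n = (\<Sum>k. real k ^ r * first_hit_prob b n k)"

text \<open>
  All divisions by \<open>b - 1\<close> are collected in the conclusion, so that for a given order \<open>r\<close> only a
  polynomial identity remains. The factor \<open>2 / b\<close> is the limit of the probability of being
  \<open>n\<close>-evil.
\<close>

lemma hit_moment_asymptotics:
  fixes N :: "real \<Rightarrow> real"
  assumes b: "b \<ge> 2" and H: "H = inverse (norm_tail b)"
    and e: "\<And>x. real b ^ 2 * x ^ r - 2 * real b * (x + 1) ^ r + (x + 2) ^ r =
      (\<Sum>m\<le>r. e m * poly (rising_poly m) x)"
    and N: "\<And>x. (\<Sum>m\<le>r. e m * 2 ^ m * (real b - 1) ^ (r - m) *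
       (\<Sum>j\<le>m. fps_nth (H ^ (m + 1)) j * poly (rising_poly (m - j)) x))
       = (real b - 1) ^ 2 * N x"
  shows "exp_small (\<lambda>n. hit_moment b r n - 2 / real b * (N (real n) / (real b - 1) ^ r))"
proof -
  let ?a = "real b - 1"
  have a: "?a \<noteq> 0" "real b \<noteq> 0" using b by auto
  let ?S = "\<lambda>m x. \<Sum>j\<le>m. fps_nth (H ^ (m + 1)) j * poly (rising_poly (m - j)) x"
  have "(\<Sum>m<Suc r. e m * (\<Sum>j<Suc m. fps_nth (inverse (fps_of_poly (tail_poly b)) ^ Suc m) j *
        poly (rising_poly (m - j)) x)) / (real b * ?a) = 2 / real b * (N x / ?a ^ r)" for x
  proof -
    have "e m * (\<Sum>j<Suc m. fps_nth (inverse (fps_of_poly (tail_poly b)) ^ Suc m) j * poly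
      (rising_poly (m - j)) x)
        = 2 / ?a ^ (r + 1) * (e m * 2 ^ m * ?a ^ (r - m) * ?S m x)" if "m \<le> r" for m
    proof -
      have "inverse (fps_of_poly (tail_poly b)) ^ Suc m =
          fps_const ((2 / ?a) ^ Suc m) * H ^ (m + 1)"
        by (simp only: inverse_tail_poly[OF b] H power_mult_distrib fps_const_power Suc_eq_plus1)
      then have 1: "(\<Sum>j<Suc m. fps_nth (inverse (fps_of_poly (tail_poly b)) ^ Suc m) j * poly
        (rising_poly (m - j)) x)
          = (2 / ?a) ^ Suc m * ?S m x"
        by (simp only: lessThan_Suc_atMost fps_mult_left_const_nth sum_distrib_left mult.assoc)
      have 2: "(2 / ?a) ^ Suc m = 2 / ?a ^ (r + 1) * (2 ^ m * ?a ^ (r - m))"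
      proof -
        have "?a ^ (r + 1) = ?a ^ Suc m * ?a ^ (r - m)"
          using that by (simp flip: power_add)
        then show ?thesis using a by (simp add: power_divide)
      qed
      show ?thesis unfolding 1 2 by (simp only: mult_ac)
    qed
    then have "(\<Sum>m<Suc r. e m * (\<Sum>j<Suc m. fps_nth (inverse (fps_of_poly (tail_poly b)) ^ Suc m) j *
        poly (rising_poly (m - j)) x)) = 2 / ?a ^ (r + 1) * (?a ^ 2 * N x)"
      unfolding lessThan_Suc_atMost N[symmetric] sum_distrib_left[of "2 / ?a ^ (r + 1)"]
        by (intro sum.cong) auto
    then show ?thesis using a by (simp add: divide_simps power2_eq_square del: sum.lessThan_Suc)
  qed
  moreover have "exp_small (\<lambda>n. (\<Sum>k. poly (monom 1 r) (real k) * first_hit_prob b n k) -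
     (\<Sum>m<Suc r. e m * (\<Sum>j<Suc m. fps_nth (inverse (fps_of_poly (tail_poly b)) ^ Suc m) j *
        poly (rising_poly (m - j)) (real n))) / (real b * (real b - 1)))"
    by (rule first_hit_moment_asymptotics[OF b]) (simp
      add: poly_monom e lessThan_Suc_atMost del: sum.lessThan_Suc)
  ultimately show ?thesis
    unfolding hit_moment_def by (simp add: poly_monom del: sum.lessThan_Suc)
qed

text \<open>
  The approximating polynomials in \<open>n\<close>: \<open>scaled_mean\<close> is \<open>b - 1\<close> times the mean, and the
  following ones are the central moments of order \<open>r\<close> multiplied by \<open>(b - 1)^r\<close>.
\<close>

definition scaled_mean :: "nat \<Rightarrow> real poly" where
  "scaled_mean b = [:(real b - 5) / 3,
     2:]"

definition scaled_central2 :: "nat \<Rightarrow> real poly" where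
  "scaled_central2 b = [:(2 * real b^2 - 14 * real b + 2) / 9,
     2 * (real b + 1) / 3:]"

definition scaled_central3 :: "nat \<Rightarrow> real poly" where
  "scaled_central3 b = [:2 * (real b + 1) * (11 * real b^2 - 95 * real b + 11) / 135,
     2 * (real b + 1)^2 / 3:]"

definition scaled_central4 :: "nat \<Rightarrow> real poly" where
  "scaled_central4 b = [:2 * (17 * real b^2 - 11 * real b + 17) * (real b^2 - 10 * real b + 1) / 135,
     2 * (real b + 1) * (13 * real b^2 - 30 * real b + 13) / 15,
     4 * (real b + 1)^2 / 3:]"

definition scaled_central5 :: "nat \<Rightarrow> real poly" where
  "scaled_central5 b = [:2 * (real b + 1) * (293 * real b^4 - 4291 * real b^3 + 7356 * real b^2
    - 4291 * real b + 293) / 1701,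
     10 * (31 * real b^2 - 118 * real b + 31) * (real b + 1)^2 / 81,
     40 * (real b + 1)^3 / 9:]"

text \<open>
  The raw moments times \<open>(b - 1)^r\<close>, obtained from the central ones by expanding the power of
  (mean + deviation). In this form the raw moments are identities that can be checked order by
  order, and the return to central moments does not depend on the values of the polynomials.
\<close>

definition scaled_raw :: "nat \<Rightarrow> nat \<Rightarrow> real poly" where
  "scaled_raw b r = (let L = scaled_mean b; C2 = scaled_central2 b; C3 = scaled_central3 b;
       C4 = scaled_central4 b; C5 = scaled_central5 b
     in [1,
         L,
         L ^ 2 + C2,
         L ^ 3 + smult 3 (L * C2) + C3,
         L ^ 4 + smult 6 (L ^ 2 * C2) + smult 4 (L * C3) + C4,
         L ^ 5 + smult 10 (L ^ 3 * C2) + smult 10 (L ^ 2 * C3) + smult 5 (L * C4) + C5] ! r)"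

lemma sum_upto_numerals:
  fixes f :: "nat \<Rightarrow> real"
  shows "(\<Sum>i\<le>1. f i) = f 0 + f 1"
    "(\<Sum>i\<le>2. f i) = f 0 + f 1 + f 2"
    "(\<Sum>i\<le>3. f i) = f 0 + f 1 + f 2 + f 3"
    "(\<Sum>i\<le>4. f i) = f 0 + f 1 + f 2 + f 3 + f 4"
    "(\<Sum>i\<le>5. f i) = f 0 + f 1 + f 2 + f 3 + f 4 + f 5"
  by (simp_all add: numeral_eq_Suc)

lemma poly_rising_poly_numerals:
  "poly (rising_poly 0) x = 1"
  "poly (rising_poly 1) x = x + 1"
  "poly (rising_poly (Suc 0)) x = x + 1"
  "poly (rising_poly 2) x = (x + 1) * (x + 2) / 2"
  "poly (rising_poly 3) x = (x + 1) * (x + 2) * (x + 3) / 6"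
  "poly (rising_poly 4) x = (x + 1) * (x + 2) * (x + 3) * (x + 4) / 24"
  "poly (rising_poly 5) x = (x + 1) * (x + 2) * (x + 3) * (x + 4) * (x + 5) / 120"
  by (simp_all add: poly_rising_poly_0 poly_rising_poly_Suc numeral_eq_Suc add_ac mult_ac)

text \<open>
  In each of the following proofs the list holds the coordinates of
  \<open>b^2 * x^r - 2 * b * (x + 1)^r + (x + 2)^r\<close> in the basis \<open>rising_poly\<close>. They arise as the
  iterated backward differences at \<open>x = -1\<close>, a point at which all basis elements except the
  constant one vanish.
\<close>

lemma hit_moment_0:
  assumes b: "b \<ge> 2"
  shows "exp_small (\<lambda>n. hit_moment b 0 n - 2 / real b * (poly (scaled_raw b 0) (real n) / (real b
    - 1) ^ 0))"
proof (rule hit_moment_asymptotics[OF b refl])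
  define H where "H = inverse (norm_tail b)"
  let ?e = "\<lambda>m. [real b^2 - 2 * real b + 1] ! m"
  show "real b ^ 2 * x ^ 0 - 2 * real b * (x + 1) ^ 0 + (x + 2) ^ 0 =
      (\<Sum>m\<le>0. ?e m * poly (rising_poly m) x)" for x
    by (simp add: sum_upto_numerals poly_rising_poly_numerals del: One_nat_def)
  show "(\<Sum>m\<le>0. ?e m * 2 ^ m * (real b - 1) ^ (0 - m) *
       (\<Sum>j\<le>m. fps_nth (inverse (norm_tail b) ^ (m + 1)) j * poly (rising_poly (m - j)) x))
       = (real b - 1) ^ 2 * poly (scaled_raw b 0) x" for x
    \<comment> \<open>As a constant of its own, \<open>H\<close> is not expanded by the rules for coefficients of inverses.\<close>
    unfolding H_def[symmetric]
    by (simp add: sum_upto_numerals poly_rising_poly_numerals inverse_norm_tail_power_nths[OF b H_def]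
        scaled_raw_def Let_def scaled_mean_def scaled_central2_def scaled_central3_def scaled_central4_def
        scaled_central5_def power2_eq_square algebra_simps)
qed

lemma hit_moment_1:
  assumes b: "b \<ge> 2"
  shows "exp_small (\<lambda>n. hit_moment b 1 n - 2 / real b * (poly (scaled_raw b 1) (real n) / (real b
    - 1) ^ 1))"
proof (rule hit_moment_asymptotics[OF b refl])
  define H where "H = inverse (norm_tail b)"
  let ?e = "\<lambda>m. [- (real b^2 - 1), real b^2 - 2 * real b + 1] ! m"
  show "real b ^ 2 * x ^ 1 - 2 * real b * (x + 1) ^ 1 + (x + 2) ^ 1 =
      (\<Sum>m\<le>1. ?e m * poly (rising_poly m) x)" for x
    by (simp add: sum_upto_numerals poly_rising_poly_numerals del: One_nat_def) algebra
  show "(\<Sum>m\<le>1. ?e m * 2 ^ m * (real b - 1) ^ (1 - m) *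
       (\<Sum>j\<le>m. fps_nth (inverse (norm_tail b) ^ (m + 1)) j * poly (rising_poly (m - j)) x))
       = (real b - 1) ^ 2 * poly (scaled_raw b 1) x" for x
    unfolding H_def[symmetric]
    by (simp add: sum_upto_numerals poly_rising_poly_numerals inverse_norm_tail_power_nths[OF b H_def]
        scaled_raw_def Let_def scaled_mean_def scaled_central2_def scaled_central3_def scaled_central4_def
        scaled_central5_def divide_simps del: One_nat_def distrib_left_numeral distrib_right_numeral) algebra
qed

lemma hit_moment_2:
  assumes b: "b \<ge> 2"
  shows "exp_small (\<lambda>n. hit_moment b 2 n - 2 / real b * (poly (scaled_raw b 2) (real n) / (real b
    - 1) ^ 2))"
proof (rule hit_moment_asymptotics[OF b refl])
  define H where "H = inverse (norm_tail b)"
  let ?e = "\<lambda>m. [real b^2 + 1, - (3 * real b^2 - 2 * real b - 1), 2 * real b^2 - 4 * real b + 2] ! m"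
  show "real b ^ 2 * x ^ 2 - 2 * real b * (x + 1) ^ 2 + (x + 2) ^ 2 =
      (\<Sum>m\<le>2. ?e m * poly (rising_poly m) x)" for x
    by (simp add: sum_upto_numerals poly_rising_poly_numerals del: One_nat_def) algebra
  show "(\<Sum>m\<le>2. ?e m * 2 ^ m * (real b - 1) ^ (2 - m) *
       (\<Sum>j\<le>m. fps_nth (inverse (norm_tail b) ^ (m + 1)) j * poly (rising_poly (m - j)) x))
       = (real b - 1) ^ 2 * poly (scaled_raw b 2) x" for x
    unfolding H_def[symmetric]
    by (simp add: sum_upto_numerals poly_rising_poly_numerals inverse_norm_tail_power_nths[OF b H_def]
        scaled_raw_def Let_def scaled_mean_def scaled_central2_def scaled_central3_def scaled_central4_def
        scaled_central5_def divide_simps del: One_nat_def distrib_left_numeral distrib_right_numeral) algebra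
qed

lemma hit_moment_3:
  assumes b: "b \<ge> 2"
  shows "exp_small (\<lambda>n. hit_moment b 3 n - 2 / real b * (poly (scaled_raw b 3) (real n) / (real b
    - 1) ^ 3))"
proof (rule hit_moment_asymptotics[OF b refl])
  define H where "H = inverse (norm_tail b)"
  let ?e = "\<lambda>m. [- (real b^2 - 1), 7 * real b^2 - 2 * real b + 1, - (12 * real b^2 - 12 * real b),
    6 * real b^2 - 12 * real b + 6] ! m"
  show "real b ^ 2 * x ^ 3 - 2 * real b * (x + 1) ^ 3 + (x + 2) ^ 3 =
      (\<Sum>m\<le>3. ?e m * poly (rising_poly m) x)" for x
    by (simp add: sum_upto_numerals poly_rising_poly_numerals del: One_nat_def) algebra
  show "(\<Sum>m\<le>3. ?e m * 2 ^ m * (real b - 1) ^ (3 - m) *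
       (\<Sum>j\<le>m. fps_nth (inverse (norm_tail b) ^ (m + 1)) j * poly (rising_poly (m - j)) x))
       = (real b - 1) ^ 2 * poly (scaled_raw b 3) x" for x
    unfolding H_def[symmetric]
    by (simp add: sum_upto_numerals poly_rising_poly_numerals inverse_norm_tail_power_nths[OF b H_def]
        scaled_raw_def Let_def scaled_mean_def scaled_central2_def scaled_central3_def scaled_central4_def
        scaled_central5_def divide_simps del: One_nat_def distrib_left_numeral distrib_right_numeral) algebra
qed

lemma hit_moment_4:
  assumes b: "b \<ge> 2"
  shows "exp_small (\<lambda>n. hit_moment b 4 n - 2 / real b * (poly (scaled_raw b 4) (real n) / (real b
    - 1) ^ 4))"
proof (rule hit_moment_asymptotics[OF b refl])
  define H where "H = inverse (norm_tail b)"
  let ?e = "\<lambda>m. [real b^2 + 1, - (15 * real b^2 - 2 * real b - 1), 50 * real b^2 - 28 * real b + 2,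
    - (60 * real b^2 - 72 * real b + 12), 24 * real b^2 - 48 * real b + 24] ! m"
  show "real b ^ 2 * x ^ 4 - 2 * real b * (x + 1) ^ 4 + (x + 2) ^ 4 =
      (\<Sum>m\<le>4. ?e m * poly (rising_poly m) x)" for x
    by (simp add: sum_upto_numerals poly_rising_poly_numerals del: One_nat_def) algebra
  show "(\<Sum>m\<le>4. ?e m * 2 ^ m * (real b - 1) ^ (4 - m) *
       (\<Sum>j\<le>m. fps_nth (inverse (norm_tail b) ^ (m + 1)) j * poly (rising_poly (m - j)) x))
       = (real b - 1) ^ 2 * poly (scaled_raw b 4) x" for x
    unfolding H_def[symmetric]
    by (simp add: sum_upto_numerals poly_rising_poly_numerals inverse_norm_tail_power_nths[OF b H_def]
        scaled_raw_def Let_def scaled_mean_def scaled_central2_def scaled_central3_def scaled_central4_def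
        scaled_central5_def divide_simps del: One_nat_def distrib_left_numeral distrib_right_numeral) algebra
qed

lemma hit_moment_5:
  assumes b: "b \<ge> 2"
  shows "exp_small (\<lambda>n. hit_moment b 5 n - 2 / real b * (poly (scaled_raw b 5) (real n) / (real b
    - 1) ^ 5))"
proof (rule hit_moment_asymptotics[OF b refl])
  define H where "H = inverse (norm_tail b)"
  let ?e = "\<lambda>m. [- (real b^2 - 1), 31 * real b^2 - 2 * real b + 1, - (180 * real b^2
    - 60 * real b), 390 * real b^2 - 300 * real b + 30, - (360 * real b^2 - 480 * real b + 120),
      120 * real b^2 - 240 * real b + 120] ! m"
  show "real b ^ 2 * x ^ 5 - 2 * real b * (x + 1) ^ 5 + (x + 2) ^ 5 =
      (\<Sum>m\<le>5. ?e m * poly (rising_poly m) x)" for x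
    by (simp add: sum_upto_numerals poly_rising_poly_numerals del: One_nat_def) algebra
  show "(\<Sum>m\<le>5. ?e m * 2 ^ m * (real b - 1) ^ (5 - m) *
       (\<Sum>j\<le>m. fps_nth (inverse (norm_tail b) ^ (m + 1)) j * poly (rising_poly (m - j)) x))
       = (real b - 1) ^ 2 * poly (scaled_raw b 5) x" for x
    unfolding H_def[symmetric]
    by (simp add: sum_upto_numerals poly_rising_poly_numerals inverse_norm_tail_power_nths[OF b H_def]
        scaled_raw_def Let_def scaled_mean_def scaled_central2_def scaled_central3_def scaled_central4_def
        scaled_central5_def divide_simps del: One_nat_def distrib_left_numeral distrib_right_numeral) algebra
qed

section \<open>Sequences that are polynomial up to an exponentially small error\<close>

text \<open>
  The second part, that \<open>g\<close> is a polynomial, is what makes the relation compatible with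
  products: an exponentially small error may be multiplied by a polynomial.
\<close>

definition asymp_poly :: "(nat \<Rightarrow> real) \<Rightarrow>
  (nat \<Rightarrow> real) \<Rightarrow> bool" where
  "asymp_poly f g \<longleftrightarrow> exp_small (\<lambda>n. f n - g n) \<and>
    (\<exists>p. \<forall>n. g n = poly p (real n))"

lemma asymp_poly_const: "asymp_poly (\<lambda>_. c) (\<lambda>_. c)"
  unfolding asymp_poly_def by (auto simp: exp_small_zero intro!: exI[of _ "[:c:]"])

lemma asymp_poly_add:
  assumes "asymp_poly f g" "asymp_poly f' g'"
  shows "asymp_poly (\<lambda>n. f n + f' n) (\<lambda>n. g n + g' n)"
proof -
  obtain p q where p: "\<forall>n. g n = poly p (real n)" "\<forall>n. g' n = poly q (real n)"
    using assms unfolding asymp_poly_def by blast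
  then have "\<forall>n. g n + g' n = poly (p + q) (real n)" by simp
  moreover have "exp_small (\<lambda>n. f n + f' n - (g n + g' n))"
    using assms exp_small_add[of "\<lambda>n. f n - g n" "\<lambda>n. f' n - g' n"]
    unfolding asymp_poly_def by (simp add: algebra_simps)
  ultimately show ?thesis unfolding asymp_poly_def by blast
qed

lemma asymp_poly_mult:
  assumes "asymp_poly f g" "asymp_poly f' g'"
  shows "asymp_poly (\<lambda>n. f n * f' n) (\<lambda>n. g n * g' n)"
proof -
  obtain p q where p: "\<forall>n. g n = poly p (real n)" "\<forall>n. g' n = poly q (real n)"
    using assms unfolding asymp_poly_def by blast
  then have "\<forall>n. g n * g' n = poly (p * q) (real n)" by simp
  moreover have "exp_small (\<lambda>n. (f n - g n) * (f' n - g' n) + (poly p (real n) * (f' n - g' n)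
    + poly q (real n) * (f n - g n)))"
    using assms unfolding asymp_poly_def
    by (intro exp_small_add exp_small_mult exp_small_poly_mult) auto
  then have "exp_small (\<lambda>n. f n * f' n - g n * g' n)"
    using p by (simp add: algebra_simps)
  ultimately show ?thesis unfolding asymp_poly_def by blast
qed

lemma asymp_poly_power: "asymp_poly f g \<Longrightarrow> asymp_poly (\<lambda>n. f n ^ k)
  (\<lambda>n. g n ^ k)"
  by (induction k) (simp_all add: asymp_poly_const asymp_poly_mult)

lemma asymp_poly_sum:
  "(\<And>i. i \<in> A \<Longrightarrow> asymp_poly (f i) (g i)) \<Longrightarrow> asymp_poly
    (\<lambda>n. \<Sum>i\<in>A. f i n) (\<lambda>n. \<Sum>i\<in>A. g i n)"
proof (induction A rule: infinite_finite_induct)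
  case (insert x A)
  then have "asymp_poly (f x) (g x)" "asymp_poly (\<lambda>n. \<Sum>i\<in>A. f i n)
    (\<lambda>n. \<Sum>i\<in>A. g i n)"
    by blast+
  from asymp_poly_add[OF this] insert show ?case by simp
qed (simp_all add: asymp_poly_const)

lemma asymp_poly_divide:
  assumes f: "asymp_poly f (\<lambda>n. c * g n)" and h: "exp_small (\<lambda>n. h n - c)" and c: "c \<noteq> 0"
  shows "asymp_poly (\<lambda>n. f n / h n) g"
proof -
  obtain p where p: "\<And>n. c * g n = poly p (real n)"
    using f unfolding asymp_poly_def by blast
  then have g: "g n = poly (smult (1 / c) p) (real n)" for n
    using c by (simp flip: p)
  have lim: "h \<longlonglongrightarrow> c"
    using exp_small_tendsto_0[OF h] by (simp add: LIM_zero_iff)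
  then have ev: "eventually (\<lambda>n. h n \<noteq> 0) sequentially"
    using c by (rule tendsto_imp_eventually_ne)
  have "(\<lambda>n. 1 / h n) \<longlonglongrightarrow> 1 / c"
    using lim c by (intro tendsto_divide tendsto_const)
  then have bdd: "(\<lambda>n. 1 / h n) \<in> O(\<lambda>_. 1)"
    by (intro bigoI_tendsto[where c = "1 / c"]) simp_all
  have "exp_small (\<lambda>n. 1 / h n * ((f n - c * g n) + (-1) * (g n * (h n - c))))"
    unfolding g using f h
    by (intro exp_small_mult_bounded[OF _ bdd] exp_small_add exp_small_cmult exp_small_poly_mult)
      (simp_all add: asymp_poly_def g)
  moreover have "eventually (\<lambda>n. f n / h n - g n = 1 / h n * ((f n - c * g n) + (-1) * (g n *
    (h n - c)))) sequentially"
    using ev by eventually_elim (simp add: field_simps)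
  ultimately have "exp_small (\<lambda>n. f n / h n - g n)"
    by (subst exp_small_cong)
  then show ?thesis using g unfolding asymp_poly_def by blast
qed

lemma asymp_poly_cong:
  assumes "asymp_poly f g" "eventually (\<lambda>n. f n = f' n) sequentially" "\<And>n. g n = g' n"
  shows "asymp_poly f' g'"
proof -
  have "g = g'" using assms(3) by auto
  moreover have "eventually (\<lambda>n. f n - g n = f' n - g n) sequentially"
    using assms(2) by eventually_elim simp
  then have "exp_small (\<lambda>n. f n - g n) \<longleftrightarrow> exp_small (\<lambda>n. f' n - g n)"
    by (rule exp_small_cong)
  with \<open>g = g'\<close> assms(1) show ?thesis unfolding asymp_poly_def by simp
qed

lemma asymp_poly_limit:
  assumes f: "asymp_poly f (\<lambda>n. poly p (real n) / c)" and "degree p \<le> d" "d > 0"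
  shows "(\<lambda>n. f n / real n ^ d) \<longlonglongrightarrow> coeff p d / c"
proof -
  have "(\<lambda>n. coeff p i * (real n ^ i / real n ^ d)) \<longlonglongrightarrow> (if i
    = d then coeff p d else 0)" if "i \<le> d" for i
  proof (cases "i = d")
    case True
    have "eventually (\<lambda>n. coeff p d * (real n ^ d / real n ^ d) = coeff p d) sequentially"
      using eventually_gt_at_top[of 0] by eventually_elim simp
    from tendsto_eventually[OF this] show ?thesis by (simp only: True refl if_True)
  next
    case False
    have "(\<lambda>n. inverse (real n) ^ (d - i)) \<longlonglongrightarrow> 0 ^ (d - i)"
      by (intro tendsto_power lim_inverse_n)
    then have "(\<lambda>n. coeff p i * inverse (real n) ^ (d - i)) \<longlonglongrightarrow> 0"
      using False that by (intro tendsto_mult_right_zero) (simp add: power_0_left)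
    moreover have "eventually (\<lambda>n. coeff p i * inverse (real n) ^ (d - i) = coeff p i *
      (real n ^ i / real n ^ d)) sequentially"
      using eventually_gt_at_top[of 0]
    proof eventually_elim
      case (elim n)
      have "real n ^ d = real n ^ i * real n ^ (d - i)" using that by (simp flip: power_add)
      then show ?case using elim by (simp add: divide_simps power_divide)
    qed
    ultimately show ?thesis using False Lim_transform_eventually by fastforce
  qed
  then have "(\<lambda>n. \<Sum>i\<le>d. coeff p i * (real n ^ i / real n ^ d)) \<longlonglongrightarrow>
    (\<Sum>i\<le>d. if i = d then coeff p d else 0)"
    by (intro tendsto_sum) auto
  moreover have "poly p x = (\<Sum>i\<le>d. coeff p i * x ^ i)" for x
    unfolding poly_altdef using assms(2)
    by (intro sum.mono_neutral_left) (auto intro!: coeff_eq_0)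
  ultimately have "(\<lambda>n. poly p (real n) / real n ^ d) \<longlonglongrightarrow> coeff p d"
    by (simp add: sum_divide_distrib)
  moreover have "(\<lambda>n. (f n - poly p (real n) / c) * inverse (real n) ^ d)
    \<longlonglongrightarrow> 0 * 0 ^ d"
    using f by (intro tendsto_mult tendsto_power lim_inverse_n exp_small_tendsto_0) (simp add: asymp_poly_def)
  ultimately have "(\<lambda>n. 1 / c * (poly p (real n) / real n ^ d)
      + (f n - poly p (real n) / c) * inverse (real n) ^ d) \<longlonglongrightarrow> 1 / c * coeff p d
        + 0 * 0 ^ d"
    by (intro tendsto_add tendsto_mult_left)
  moreover have "1 / c * (poly p (real n) / real n ^ d) + (f n - poly p (real n) / c) * inverse (real n) ^ d
      = f n / real n ^ d" for n
    by (simp add: divide_inverse power_inverse algebra_simps)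
  ultimately show ?thesis by simp
qed

section \<open>Central moments\<close>

text \<open>
  The law of the location under the conditioned measure has a density on the natural numbers, so
  the integral is a series.
\<close>

lemma evil_integral:
  assumes b: "b \<ge> 2" and f: "summable (\<lambda>k. norm (f k * first_hit_prob b n k))"
  shows "(\<integral>d. f (evil_location n d) \<partial>evil_digits b n) =
    (\<Sum>k. f k * first_hit_prob b n k) / (\<Sum>k. first_hit_prob b n k)"
proof -
  interpret E: prob_space "evil_digits b n" by (rule prob_space_evil_digits[OF b])
  have meas: "evil_location n \<in> measurable (evil_digits b n) (count_space UNIV)"
    unfolding evil_digits_def by simp
  let ?s = "\<Sum>k. first_hit_prob b n k"
  define q where "q k = first_hit_prob b n k / ?s" for k
  have q: "q k = E.prob {d \<in> space (evil_digits b n). evil_location n d = k}" for k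
    by (simp add: q_def evil_location_law[OF b])
  have q0: "q k \<ge> 0" for k by (simp add: q)
  have "distr (evil_digits b n) (count_space UNIV) (evil_location n) = density (count_space UNIV)
    (\<lambda>k. ennreal (q k))"
  proof (rule measure_eqI_countable[of _ UNIV])
    fix k
    have "emeasure (distr (evil_digits b n) (count_space UNIV) (evil_location n)) {k} =
        emeasure (evil_digits b n) {d \<in> space (evil_digits b n). evil_location n d = k}"
      using meas by (subst emeasure_distr) (auto intro!: arg_cong[of _ _ "emeasure _"])
    also have "\<dots> = ennreal (q k)" by (simp add: q E.emeasure_eq_measure)
    also have "\<dots> = emeasure (density (count_space UNIV) (\<lambda>k. ennreal (q k))) {k}"
      by (subst emeasure_density)
        (auto simp: nn_integral_count_space_indicator[symmetric] nn_integral_indicator_singleton)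
    finally show "emeasure (distr (evil_digits b n) (count_space UNIV) (evil_location n)) {k} =
      emeasure (density (count_space UNIV) (\<lambda>k. ennreal (q k))) {k}" .
  qed auto
  then have "(\<integral>d. f (evil_location n d) \<partial>evil_digits b n) =
      (\<integral>k. f k \<partial>density (count_space UNIV) (\<lambda>k. ennreal (q k)))"
    using integral_distr[OF meas, of f] by simp
  also have "\<dots> = (\<integral>k. q k * f k \<partial>count_space UNIV)"
    using q0 by (subst integral_density) auto
  also have "\<dots> = (\<Sum>k. q k * f k)"
  proof (rule integral_count_space_nat)
    have "summable (\<lambda>k. norm (f k * first_hit_prob b n k) / norm ?s)"
      by (intro summable_divide f)
    then show "integrable (count_space UNIV) (\<lambda>k. q k * f k)"
      unfolding integrable_count_space_nat_iff
      by (simp add: q_def abs_mult mult.commute)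
  qed
  also have "\<dots> = (\<Sum>k. f k * first_hit_prob b n k) / ?s"
    unfolding q_def using suminf_divide[OF summable_norm_cancel[OF f], of ?s] by (simp add: mult.commute)
  finally show ?thesis .
qed

text \<open>
  Convergence without absolute values is known for every polynomial, and the probabilities are
  nonnegative; so \<open>\<bar>p\<bar> \<le> 1 + p^2\<close> yields absolute convergence.
\<close>

lemma summable_norm_poly_first_hit:
  assumes b: "b \<ge> 2" and n: "n > 0"
  shows "summable (\<lambda>k. norm (poly p (real k) * first_hit_prob b n k))"
proof (rule summable_comparison_test')
  show "summable (\<lambda>k. poly (1 + p * p) (real k) * first_hit_prob b n k)"
    using first_hit_poly_sums[OF b n] by (rule sums_summable)
  fix k
  have "\<bar>poly p (real k)\<bar> \<le> 1 + poly p (real k) * poly p (real k)"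
    using zero_le_square[of "\<bar>poly p (real k)\<bar> - 1"] zero_le_square[of "poly p (real k)"]
    by (simp add: algebra_simps)
  moreover have "0 \<le> first_hit_prob b n k"
    by (simp add: first_hit_prob_def)
  ultimately show "norm (norm (poly p (real k) * first_hit_prob b n k)) \<le>
      poly (1 + p * p) (real k) * first_hit_prob b n k"
    by (simp add: abs_mult mult_right_mono)
qed

lemma evil_central_sum:
  assumes b: "b \<ge> 2" and n: "n > 0"
  shows "(\<integral>d. (real (evil_location n d) - c) ^ r \<partial>evil_digits b n) =
    (\<Sum>i\<le>r. real (r choose i) * (hit_moment b i n / hit_moment b 0 n) * (- c) ^ (r - i))"
proof -
  have summ: "summable (\<lambda>k. norm ((real k - c) ^ r * first_hit_prob b n k))"
    using summable_norm_poly_first_hit[OF b n, of "[:-c, 1:] ^ r"]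
    by (simp add: poly_power)
  have summ': "summable (\<lambda>k. real k ^ i * first_hit_prob b n k)" for i
    using summable_norm_cancel[OF summable_norm_poly_first_hit[OF b n, of "monom 1 i"]]
    by (simp add: poly_monom)
  have "(\<Sum>k. (real k - c) ^ r * first_hit_prob b n k) =
      (\<Sum>k. \<Sum>i\<le>r. (real (r choose i) * (- c) ^ (r - i)) * (real k ^ i * first_hit_prob b n k))"
    using binomial_ring[of "real _" "- c" r] by (simp add: sum_distrib_left sum_distrib_right mult_ac)
  also have "\<dots> = (\<Sum>i\<le>r. (real (r choose i) * (- c) ^ (r - i)) * hit_moment b i n)"
    unfolding hit_moment_def by (subst suminf_sum) (simp_all add: summable_mult summ' suminf_mult)
  finally show ?thesis
    using evil_integral[OF b, of "\<lambda>k. (real k - c) ^ r", OF summ]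
    by (simp add: hit_moment_def[of b 0] sum_divide_distrib mult_ac)
qed

lemma evil_mean_eq:
  assumes b: "b \<ge> 2" and n: "n > 0"
  shows "evil_mean b n = hit_moment b 1 n / hit_moment b 0 n"
  using evil_central_sum[OF assms, of 0 1] unfolding evil_mean_def by simp

text \<open>
  Conditioning on being \<open>n\<close>-evil divides by the moment of order \<open>0\<close>.
\<close>

lemma raw_moment_asymp:
  assumes b: "b \<ge> 2" and r: "r \<le> 5"
  shows "asymp_poly (\<lambda>n. hit_moment b r n / hit_moment b 0 n)
    (\<lambda>n. poly (scaled_raw b r) (real n) / (real b - 1) ^ r)"
proof (rule asymp_poly_divide)
  have "r \<in> {0, 1, 2, 3, 4, 5}" using r by auto
  then have "exp_small (\<lambda>n. hit_moment b r n - 2 / real b * (poly (scaled_raw b r) (real n) /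
    (real b - 1) ^ r))"
    using hit_moment_0[OF b] hit_moment_1[OF b] hit_moment_2[OF b] hit_moment_3[OF b]
      hit_moment_4[OF b] hit_moment_5[OF b] by blast
  then show "asymp_poly (hit_moment b r) (\<lambda>n. 2 / real b * (poly (scaled_raw b r) (real n) /
    (real b - 1) ^ r))"
    unfolding asymp_poly_def
    by (intro conjI exI[of _ "smult (2 / real b / (real b - 1) ^ r) (scaled_raw b r)"]) simp_all
  show "exp_small (\<lambda>n. hit_moment b 0 n - 2 / real b)"
    using hit_moment_0[OF b] by (simp add: scaled_raw_def Let_def)
qed (use b in auto)

lemma evil_mean_asymp:
  assumes b: "b \<ge> 2"
  shows "asymp_poly (evil_mean b) (\<lambda>n. poly (scaled_mean b) (real n) / (real b - 1))"
  by (rule asymp_poly_cong[OF raw_moment_asymp[OF b, of 1]])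
    (auto simp: evil_mean_eq[OF b] scaled_raw_def Let_def intro!: eventually_mono[OF eventually_gt_at_top[of 0]])

text \<open>
  Expanding the power binomially expresses the central moment by raw moments. The powers of
  \<open>b - 1\<close> in the denominators agree in all terms, so the approximating polynomials can be
  compared without them.
\<close>

lemma evil_central_moment_asymp:
  assumes b: "b \<ge> 2" and r: "r \<le> 5"
    and C: "\<And>x. (\<Sum>i\<le>r. real (r choose i) * poly (scaled_raw b i) x * (- poly
      (scaled_mean b) x) ^ (r - i))
      = poly C x"
  shows "asymp_poly (evil_central_moment r b) (\<lambda>n. poly C (real n) / (real b - 1) ^ r)"
proof (rule asymp_poly_cong)
  let ?a = "real b - 1"
  let ?N = "\<lambda>i n. poly (scaled_raw b i) (real n)"
  \<comment> \<open>The sign is a constant factor so that closure under products covers it.\<close>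
  show "asymp_poly
      (\<lambda>n. \<Sum>i\<le>r. real (r choose i) * (hit_moment b i n / hit_moment b 0 n) *
        ((-1) * evil_mean b n) ^ (r - i))
      (\<lambda>n. \<Sum>i\<le>r. real (r choose i) * (?N i n / ?a ^ i) * ((-1) * (poly (scaled_mean b)
        (real n) / ?a)) ^ (r - i))"
    using r by (intro asymp_poly_sum asymp_poly_mult asymp_poly_power asymp_poly_const
        raw_moment_asymp[OF b] evil_mean_asymp[OF b]) auto
  show "eventually (\<lambda>n. (\<Sum>i\<le>r. real (r choose i) * (hit_moment b i n / hit_moment b 0 n) *
      ((-1) * evil_mean b n) ^ (r - i)) = evil_central_moment r b n) sequentially"
    using eventually_gt_at_top[of 0]
    by eventually_elim (simp add: evil_central_moment_def evil_central_sum[OF b])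
  fix n :: nat
  have "real (r choose i) * (?N i n / ?a ^ i) * ((-1) * (poly (scaled_mean b) (real n) / ?a)) ^ (r - i) =
      real (r choose i) * ?N i n * (- poly (scaled_mean b) (real n)) ^ (r - i) / ?a ^ r"
    if "i \<le> r" for i
  proof -
    have "?a ^ r = ?a ^ i * ?a ^ (r - i)" using that by (simp flip: power_add)
    moreover have "(-1) * (poly (scaled_mean b) (real n) / ?a) = (- poly (scaled_mean b) (real n)) / ?a"
      by simp
    ultimately show ?thesis by
      (simp only: power_divide times_divide_times_eq times_divide_eq_right times_divide_eq_left mult.assoc divide_divide_eq_left)
  qed
  then show "(\<Sum>i\<le>r. real (r choose i) * (?N i n / ?a ^ i) * ((-1) * (poly (scaled_mean b)
    (real n) / ?a)) ^ (r - i))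
      = poly C (real n) / ?a ^ r"
    unfolding C[symmetric] sum_divide_distrib by (intro sum.cong refl) auto
qed

lemma choose_numerals:
  "(2::nat) choose 1 = 2" "(3::nat) choose 1 = 3" "(4::nat) choose 1 = 4" "(5::nat) choose 1 = 5"
  "(3::nat) choose 2 = 3"
  "(4::nat) choose 2 = 6" "(4::nat) choose 3 = 4"
  "(5::nat) choose 2 = 10" "(5::nat) choose 3 = 10" "(5::nat) choose 4 = 5"
  by (simp_all add: numeral_eq_Suc)

lemmas scaled_raw_simps = scaled_raw_def Let_def sum_upto_numerals

lemma evil_variance_asymp:
  assumes "b \<ge> 2"
  shows "asymp_poly (evil_variance b) (\<lambda>n. poly (scaled_central2 b) (real n) / (real b - 1) ^ 2)"
  unfolding evil_variance_def[abs_def]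
  by (rule evil_central_moment_asymp[OF assms]) (simp_all
    add: scaled_raw_simps choose_numerals power2_eq_square del: One_nat_def)

lemma evil_central_moment_3_asymp:
  assumes "b \<ge> 2"
  shows "asymp_poly (evil_central_moment 3 b) (\<lambda>n. poly (scaled_central3 b) (real n) / (real b
    - 1) ^ 3)"
proof (rule evil_central_moment_asymp[OF assms])
  show "(\<Sum>i\<le>3. real (3 choose i) * poly (scaled_raw b i) x * (- poly (scaled_mean b) x) ^ (3 - i))
      = poly (scaled_central3 b) x" for x
    by (simp add: scaled_raw_simps choose_numerals del: One_nat_def) algebra
qed simp

lemma evil_central_moment_4_asymp:
  assumes "b \<ge> 2"
  shows "asymp_poly (evil_central_moment 4 b) (\<lambda>n. poly (scaled_central4 b) (real n) / (real b
    - 1) ^ 4)"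
proof (rule evil_central_moment_asymp[OF assms])
  show "(\<Sum>i\<le>4. real (4 choose i) * poly (scaled_raw b i) x * (- poly (scaled_mean b) x) ^ (4 - i))
      = poly (scaled_central4 b) x" for x
    by (simp add: scaled_raw_simps choose_numerals del: One_nat_def) algebra
qed simp

lemma evil_central_moment_5_asymp:
  assumes "b \<ge> 2"
  shows "asymp_poly (evil_central_moment 5 b) (\<lambda>n. poly (scaled_central5 b) (real n) / (real b
    - 1) ^ 5)"
proof (rule evil_central_moment_asymp[OF assms])
  show "(\<Sum>i\<le>5. real (5 choose i) * poly (scaled_raw b i) x * (- poly (scaled_mean b) x) ^ (5 - i))
      = poly (scaled_central5 b) x" for x
    by (simp add: scaled_raw_simps choose_numerals del: One_nat_def) algebra
qed simp

text \<open>
  A moment of order \<open>n^d\<close> is negligible against \<open>V^s\<close> as soon as \<open>s > d\<close>, since \<open>V\<close> grows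
  linearly.
\<close>

lemma scaled_moment_limit:
  assumes V: "(\<lambda>n. V n / real n)
    \<longlonglongrightarrow> v" "v > 0" and f: "(\<lambda>n. f n / real n ^ d) \<longlonglongrightarrow> c"
    and s: "s > real d"
  shows "(\<lambda>n. f n / V n powr s) \<longlonglongrightarrow> 0"
proof -
  have "(\<lambda>n. real n powr (real d - s)) \<longlonglongrightarrow> 0"
    using s by (intro tendsto_neg_powr filterlim_real_sequentially) auto
  then have "(\<lambda>n. f n / real n ^ d / (V n / real n) powr s * real n powr (real d
    - s)) \<longlonglongrightarrow> c / v powr s * 0"
    using V f by (intro tendsto_mult tendsto_divide tendsto_powr tendsto_const) auto
  moreover have "eventually (\<lambda>n. V n / real n > 0) sequentially"
    using order_tendstoD(1)[OF V] .
  then have "eventually (\<lambda>n. f n / real n ^ d / (V n / real n) powr s * real n powr (real d - s)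
    = f n / V n powr s) sequentially"
    using eventually_gt_at_top[of 0]
  proof eventually_elim
    case (elim n)
    have "V n powr s = (V n / real n) powr s * real n powr s"
      using elim by (simp flip: powr_mult)
    moreover have "real n powr s * real n powr (real d - s) = real n ^ d"
      using elim by (simp flip: powr_add add: powr_realpow)
    ultimately show ?case using elim by (simp add: field_simps)
  qed
  ultimately show ?thesis using Lim_transform_eventually by fastforce
qed

section \<open>The asymptotic expansions\<close>

theorem theorem3:
  fixes b :: nat
  assumes "b \<ge> 2"
  shows "\<exists>\<alpha>::real. 0 < \<alpha> \<and> \<alpha> < 1 \<and>
    (\<lambda>n. evil_mean b n
        - (2 / (real b - 1) * real n + (real b - 5) / (3 * (real b
        - 1)))) \<in> O(\<lambda>n. \<alpha> ^ n) \<and>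
    (\<lambda>n. evil_variance b n
        - (2 * (real b + 1) / (3 * (real b - 1)^2) * real n
           + (2 * real b^2 - 14 * real b + 2) / (9 * (real b - 1)^2))) \<in> O(\<lambda>n. \<alpha> ^ n) \<and>
    (\<lambda>n. evil_central_moment 3 b n
        - (2 * (real b + 1)^2 / (3 * (real b - 1)^3) * real n
           + 2 * (real b + 1) * (11 * real b^2 - 95 * real b + 11)
               / (135 * (real b - 1)^3))) \<in> O(\<lambda>n. \<alpha> ^ n) \<and>
    (\<lambda>n. evil_central_moment 3 b n / evil_variance b n powr (3 / 2)) \<longlonglongrightarrow> 0 \<and>
    (\<lambda>n. evil_central_moment 4 b n
        - (4 * (real b + 1)^2 / (3 * (real b - 1)^4) * real n^2
           + 2 * (real b + 1) * (13 * real b^2 - 30 * real b + 13)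
               / (15 * (real b - 1)^4) * real n
           + 2 * (17 * real b^2 - 11 * real b + 17) * (real b^2 - 10 * real b + 1)
               / (135 * (real b - 1)^4))) \<in> O(\<lambda>n. \<alpha> ^ n) \<and>
    (\<lambda>n. evil_central_moment 4 b n / (evil_variance b n)^2) \<longlonglongrightarrow> 3 \<and>
    (\<lambda>n. evil_central_moment 5 b n
        - (40 * (real b + 1)^3 / (9 * (real b - 1)^5) * real n^2
           + 10 * (31 * real b^2 - 118 * real b + 31) * (real b + 1)^2
               / (81 * (real b - 1)^5) * real n
           + 2 * (real b + 1)
               * (293 * real b^4 - 4291 * real b^3 + 7356 * real b^2 - 4291 * real b + 293)
               / (1701 * (real b - 1)^5))) \<in> O(\<lambda>n. \<alpha> ^ n) \<and>
    (\<lambda>n. evil_central_moment 5 b n / evil_variance b n powr (5 / 2)) \<longlonglongrightarrow> 0"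
proof -
  have a: "real b - 1 > 0" using assms by simp
  note A1 = evil_mean_asymp[OF assms] and A2 = evil_variance_asymp[OF assms]
    and A3 = evil_central_moment_3_asymp[OF assms] and A4 = evil_central_moment_4_asymp[OF assms]
    and A5 = evil_central_moment_5_asymp[OF assms]
  note scaled = scaled_mean_def scaled_central2_def scaled_central3_def scaled_central4_def scaled_central5_def

  define v where "v = 2 * (real b + 1) / 3 / (real b - 1) ^ 2"
  have "(\<lambda>n. evil_variance b n / real n ^ 1) \<longlonglongrightarrow> coeff
    (scaled_central2 b) 1 / (real b - 1) ^ 2"
    by (rule asymp_poly_limit[OF A2]) (simp_all add: scaled)
  then have lim2: "(\<lambda>n. evil_variance b n / real n) \<longlonglongrightarrow> v"
    by (simp add: scaled v_def)
  have v: "v > 0" using a by (simp add: v_def)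
  have lim3: "(\<lambda>n. evil_central_moment 3 b n / real n ^ 1) \<longlonglongrightarrow> coeff
    (scaled_central3 b) 1 / (real b - 1) ^ 3"
    by (rule asymp_poly_limit[OF A3]) (simp_all add: scaled)
  have lim4: "(\<lambda>n. evil_central_moment 4 b n / real n ^ 2) \<longlonglongrightarrow> coeff
    (scaled_central4 b) 2 / (real b - 1) ^ 4"
    by (rule asymp_poly_limit[OF A4]) (simp_all add: scaled)
  have lim5: "(\<lambda>n. evil_central_moment 5 b n / real n ^ 2) \<longlonglongrightarrow> coeff
    (scaled_central5 b) 2 / (real b - 1) ^ 5"
    by (rule asymp_poly_limit[OF A5]) (simp_all add: scaled)
  have skew: "(\<lambda>n. evil_central_moment 3 b n / evil_variance b n powr
    (3 / 2)) \<longlonglongrightarrow> 0"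
    by (rule scaled_moment_limit[OF lim2 v lim3]) simp
  have fifth: "(\<lambda>n. evil_central_moment 5 b n / evil_variance b n powr
    (5 / 2)) \<longlonglongrightarrow> 0"
    by (rule scaled_moment_limit[OF lim2 v lim5]) simp
  have kurt: "(\<lambda>n. evil_central_moment 4 b n / (evil_variance b n)^2) \<longlonglongrightarrow> 3"
  proof -
    have "(\<lambda>n. evil_central_moment 4 b n / real n ^ 2 / (evil_variance b n / real n) ^ 2)
        \<longlonglongrightarrow> coeff (scaled_central4 b) 2 / (real b - 1) ^ 4 / v ^ 2"
      using v by (intro tendsto_divide tendsto_power lim2 lim4) auto
    also have "coeff (scaled_central4 b) 2 / (real b - 1) ^ 4 / v ^ 2 = 3"
    proof -
      have "coeff (scaled_central4 b) 2 = 4 * (real b + 1) ^ 2 / 3"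
        by (simp add: scaled numeral_2_eq_2)
      moreover have "v ^ 2 = 4 * (real b + 1) ^ 2 / 9 / (real b - 1) ^ 4"
        by (simp add: v_def power_divide power_mult_distrib del: distrib_left_numeral)
      moreover have "real b - 1 \<noteq> 0" "real b + 1 \<noteq> 0" using a by auto
      ultimately show ?thesis by (simp only:) (simp add: divide_simps)
    qed
    finally have "(\<lambda>n. evil_central_moment 4 b n / real n ^ 2 /
      (evil_variance b n / real n) ^ 2) \<longlonglongrightarrow> 3" .
    moreover have "eventually (\<lambda>n. evil_central_moment 4 b n / real n ^ 2 /
      (evil_variance b n / real n) ^ 2
        = evil_central_moment 4 b n / (evil_variance b n)^2) sequentially"
      using eventually_gt_at_top[of 0] by eventually_elim (simp add: power_divide)
    ultimately show ?thesis by (rule Lim_transform_eventually)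
  qed

  let ?F = "{\<lambda>n. evil_mean b n - poly (scaled_mean b) (real n) / (real b - 1),
    \<lambda>n. evil_variance b n - poly (scaled_central2 b) (real n) / (real b - 1) ^ 2,
    \<lambda>n. evil_central_moment 3 b n - poly (scaled_central3 b) (real n) / (real b - 1) ^ 3,
    \<lambda>n. evil_central_moment 4 b n - poly (scaled_central4 b) (real n) / (real b - 1) ^ 4,
    \<lambda>n. evil_central_moment 5 b n - poly (scaled_central5 b) (real n) / (real b - 1) ^ 5}"
  have "\<And>f. f \<in> ?F \<Longrightarrow> exp_small f"
    using A1 A2 A3 A4 A5 unfolding asymp_poly_def by blast
  then obtain \<alpha> :: real where \<alpha>: "0 < \<alpha>" "\<alpha> < 1" "\<forall>f\<in>?F. f \<in> O(\<lambda>n. \<alpha> ^ n)"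
    using exp_small_common_rate[of ?F] by blast
  have P1: "poly (scaled_mean b) x / (real b - 1)
      = 2 / (real b - 1) * x + (real b - 5) / (3 * (real b - 1))" for x
    using a by (simp add: scaled add_divide_distrib)
  have P2: "poly (scaled_central2 b) x / (real b - 1) ^ 2
      = 2 * (real b + 1) / (3 * (real b - 1)^2) * x
           + (2 * real b^2 - 14 * real b + 2) / (9 * (real b - 1)^2)" for x
    unfolding scaled poly_pCons poly_0 by (simp add: add_divide_distrib distrib_left mult_ac add_ac)
  have P3: "poly (scaled_central3 b) x / (real b - 1) ^ 3
      = 2 * (real b + 1)^2 / (3 * (real b - 1)^3) * x
           + 2 * (real b + 1) * (11 * real b^2 - 95 * real b + 11) / (135 * (real b - 1)^3)" for x
    unfolding scaled poly_pCons poly_0 by (simp add: add_divide_distrib mult_ac)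
  have P4: "poly (scaled_central4 b) x / (real b - 1) ^ 4
      = 4 * (real b + 1)^2 / (3 * (real b - 1)^4) * x^2
           + 2 * (real b + 1) * (13 * real b^2 - 30 * real b + 13) / (15 * (real b - 1)^4) * x
           + 2 * (17 * real b^2 - 11 * real b + 17) * (real b^2 - 10 * real b + 1)
               / (135 * (real b - 1)^4)" for x
    unfolding scaled poly_pCons poly_0 by (simp add: add_divide_distrib distrib_left power2_eq_square mult_ac)
  have P5: "poly (scaled_central5 b) x / (real b - 1) ^ 5
      = 40 * (real b + 1)^3 / (9 * (real b - 1)^5) * x^2
           + 10 * (31 * real b^2 - 118 * real b + 31) * (real b + 1)^2 / (81 * (real b - 1)^5) * x
           + 2 * (real b + 1)
               * (293 * real b^4 - 4291 * real b^3 + 7356 * real b^2 - 4291 * real b + 293)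
               / (1701 * (real b - 1)^5)" for x
    unfolding scaled poly_pCons poly_0 by (simp add: add_divide_distrib distrib_left power2_eq_square mult_ac)
  from \<alpha> show ?thesis
    unfolding P1 P2 P3 P4 P5
    by (intro exI[of _ \<alpha>] conjI skew fifth kurt) simp_all
qed

end
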